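(* Let $t$, $m$ and $k$ be non-negative integers and write $s=\lfloor t/2\rfloor$. The following five sets are pairwise in bijection: (a) the set of self-conjugate $t$-core partitions with $m$ corners such that $h(1,1)<kt$; (b) the set of integer sequences $(n_0,n_1,\dots,n_{s-1})$ such that $n_0$ is positive if $m$ is odd and non-positive if $m$ is even, $-\lfloor k/2\rfloor\le n_i\le \lfloor (k+1)/2\rfloor$ for all $i$, and $\sum_{i=0}^{s}|n_i-n_{i-1}|$ equals $m+1$ if $m$ is odd and $m$ if $m$ is even, where one sets $n_{-1}:=0$ and $n_s:=0$; (c) the set $\mathcal{F}_{\rm c}(m,s,k)$; (d) the set $\mathcal{M}_{\rm c}(m,s,k)$; (e) the set of cornerless symmetric Motzkin paths of length $2m+t-1$ with exactly $t-1$ flat steps that are contained in the strip $0\le y\le k$.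
   Context: Partitions, Young diagrams, hook lengths $h(i,j)$: a partition is a non-increasing finite sequence of positive integers; the hook length of a box is the number of boxes to its right, below it, plus one. An inner corner is a box whose removal leaves the Young diagram of a partition; "$m$ corners" means exactly $m$ inner corners. A partition is a $t$-core if no box has hook length $t$. The conjugate $\lambda'$ has $\lambda'_j$ equal to the number of boxes in column $j$ of $\lambda$; $\lambda$ is self-conjugate if $\lambda=\lambda'$. (For the empty partition the condition $h(1,1)<kt$ is regarded as satisfied.) Paths use steps $u=(1,1)$, $d=(1,-1)$, $f=(1,0)$; write $\overline{u}=d$, $\overline{d}=u$, $\overline{f}=f$. A peak (valley) is a vertex preceded by an up (down) step and followed by a down (up) step; a path is cornerless if it has neither. A Motzkin path of length $n$ goes from $(0,0)$ to $(n,0)$ and stays weakly above the $x$-axis; it is symmetric if its step sequence $p_1\cdots p_n$ satisfies $p_{n+1-i}=\overline{p_i}$ for all $i$. A free Motzkin path of length $n$ starts at $(0,0)$ or $(0,1)$ and ends at $(n,0)$ (no positivity requirement). A Motzkin prefix of length $n$ starts at $(0,0)$ and stays weakly above the $x$-axis, with arbitrary endpoint. For non-negative integers $m,r,k$: $\mathcal{F}(m,r,k)$ is the set of free Motzkin paths of length $m+r$ with exactly $r$ flat steps contained in the strip $-\lfloor k/2\rfloor\le y\le\lfloor (k+1)/2\rfloor$; $L_k$ is the line $y=\lfloor (k+1)/2\rfloor$ for odd $k$ and $y=-\lfloor k/2\rfloor$ for even $k$; $\overline{\mathcal{F}}(m,r,k)$ is the set of paths in $\mathcal{F}(m,r,k)$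 touching $L_k$; $\overline{\mathcal{F}}_{\rm c}(m,r,k)$ is the set of cornerless paths in $\overline{\mathcal{F}}(m,r,k)$ that do not start with a down step if $m$ is odd and do not start with an up step if $m$ is even; $\mathcal{F}_{\rm c}(m,r,k)=\bigcup_{i=0}^{k}\overline{\mathcal{F}}_{\rm c}(m,r,i)$. Similarly $\mathcal{M}(m,r,k)$ is the set of Motzkin prefixes of length $m+r$ with exactly $r$ flat steps contained in $0\le y\le k$; $\overline{\mathcal{M}}(m,r,k)$ consists of those touching $y=k$; $\overline{\mathcal{M}}_{\rm c}(m,r,k)$ consists of the cornerless paths in $\overline{\mathcal{M}}(m,r,k)$ ending with a flat step; $\mathcal{M}_{\rm c}(m,r,k)=\bigcup_{i=0}^{k}\overline{\mathcal{M}}_{\rm c}(m,r,i)$.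
   Formalization: In (d), when m=s=0, the empty prefix is counted as ending with a flat step; in (e), when t=m=0, the set is taken to consist of the empty path (length and number of flat steps 0 instead of -1). Read literally these sets are empty while (a) has one element. *)

theory Defs
  imports Main "HOL-Library.Equipollence"
begin

section \<open>Partitions\<close>

definition is_partition :: "nat list \<Rightarrow> bool" where
  "is_partition l \<longleftrightarrow> sorted_wrt (\<ge>) l \<and> (\<forall>x \<in> set l. 0 < x)"

text \<open>Boxes are pairs (row, column), both counted from 1; lists are indexed from 0.\<close>

definition young_diagram :: "nat list \<Rightarrow> (nat \<times> nat) set" where
  "young_diagram l = {(i, j). 1 \<le> i \<and> i \<le> length l \<and> 1 \<le> j \<and> j \<le> l ! (i - 1)}"

definition hook_length :: "nat list \<Rightarrow> nat \<Rightarrow> nat \<Rightarrow> nat" where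
  "hook_length l i j =
     card {j'. j < j' \<and> (i, j') \<in> young_diagram l} +
     card {i'. i < i' \<and> (i', j) \<in> young_diagram l} + 1"

definition inner_corners :: "nat list \<Rightarrow> (nat \<times> nat) set" where
  "inner_corners l =
     {c \<in> young_diagram l. \<exists>l'. is_partition l' \<and> young_diagram l' = young_diagram l - {c}}"

definition t_core :: "nat \<Rightarrow> nat list \<Rightarrow> bool" where
  "t_core t l \<longleftrightarrow> (\<forall>(i, j) \<in> young_diagram l. hook_length l i j \<noteq> t)"

definition conjugate :: "nat list \<Rightarrow> nat list" where
  "conjugate l =
     map (\<lambda>j. card {i. (i, j) \<in> young_diagram l}) [1..<Suc (if l = [] then 0 else hd l)]"

definition self_conjugate :: "nat list \<Rightarrow> bool" where
  "self_conjugate l \<longleftrightarrow> conjugate l = l"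

text \<open>The empty partition has no box (1, 1); the bound on h(1,1) is regarded as satisfied for it.\<close>

definition self_conjugate_cores :: "nat \<Rightarrow> nat \<Rightarrow> nat \<Rightarrow> nat list set" where
  "self_conjugate_cores t m k =
     {l. is_partition l \<and> self_conjugate l \<and> t_core t l \<and> card (inner_corners l) = m \<and>
         (l = [] \<or> hook_length l 1 1 < k * t)}"

section \<open>Integer sequences\<close>

text \<open>A sequence \<open>n\<^sub>0, \<dots>, n\<^sub>s\<^sub>-\<^sub>1\<close> is a list of length \<open>s\<close>. The extension
  covers the boundary values \<open>0\<close> at positions \<open>-1\<close> and \<open>s\<close>; in particular, for \<open>s = 0\<close>
  the value at position \<open>0\<close> is \<open>0\<close>.\<close>

definition seq_ext :: "int list \<Rightarrow> int \<Rightarrow> int" where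
  "seq_ext ns i = (if 0 \<le> i \<and> i < int (length ns) then ns ! nat i else 0)"

definition core_sequences :: "nat \<Rightarrow> nat \<Rightarrow> nat \<Rightarrow> int list set" where
  "core_sequences s m k =
     {ns. length ns = s \<and>
          (if odd m then 0 < seq_ext ns 0 else seq_ext ns 0 \<le> 0) \<and>
          (\<forall>x \<in> set ns. - int (k div 2) \<le> x \<and> x \<le> int ((k + 1) div 2)) \<and>
          (\<Sum>i = 0..int s. \<bar>seq_ext ns i - seq_ext ns (i - 1)\<bar>) =
            (if odd m then int m + 1 else int m)}"

section \<open>Lattice paths\<close>

datatype step = U | D | F

fun step_rise :: "step \<Rightarrow> int" where
  "step_rise U = 1"
| "step_rise D = - 1"
| "step_rise F = 0"

fun step_bar :: "step \<Rightarrow> step" where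
  "step_bar U = D"
| "step_bar D = U"
| "step_bar F = F"

text \<open>A path is given by the height \<open>a\<close> of its starting point on the y-axis and its list of steps;
  \<open>height a p i\<close> is the y-coordinate of its vertex with x-coordinate \<open>i \<le> length p\<close>.\<close>

definition height :: "int \<Rightarrow> step list \<Rightarrow> nat \<Rightarrow> int" where
  "height a p i = a + sum_list (map step_rise (take i p))"

definition in_strip :: "int \<Rightarrow> int \<Rightarrow> int \<Rightarrow> step list \<Rightarrow> bool" where
  "in_strip lo hi a p \<longleftrightarrow> (\<forall>i \<le> length p. lo \<le> height a p i \<and> height a p i \<le> hi)"

text \<open>A path meets a horizontal line of integer height only if one of its vertices is on it.\<close>

definition touches :: "int \<Rightarrow> int \<Rightarrow> step list \<Rightarrow> bool" where
  "touches y a p \<longleftrightarrow> (\<exists>i \<le> length p. height a p i = y)"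

definition cornerless :: "step list \<Rightarrow> bool" where
  "cornerless p \<longleftrightarrow>
     (\<forall>i. Suc i < length p \<longrightarrow>
        \<not> (p ! i = U \<and> p ! Suc i = D) \<and> \<not> (p ! i = D \<and> p ! Suc i = U))"

definition starts_with :: "step \<Rightarrow> step list \<Rightarrow> bool" where
  "starts_with x p \<longleftrightarrow> p \<noteq> [] \<and> hd p = x"

definition symmetric_path :: "step list \<Rightarrow> bool" where
  "symmetric_path p \<longleftrightarrow> (\<forall>i < length p. p ! (length p - 1 - i) = step_bar (p ! i))"

subsection \<open>Free Motzkin paths\<close>

definition free_motzkin_paths :: "nat \<Rightarrow> (int \<times> step list) set" where
  "free_motzkin_paths n =
     {(a, p). a \<in> {0, 1} \<and> length p = n \<and> height a p n = 0}"

definition Free :: "nat \<Rightarrow> nat \<Rightarrow> nat \<Rightarrow> (int \<times> step list) set" where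
  "Free m r k =
     {(a, p) \<in> free_motzkin_paths (m + r).
        count_list p F = r \<and> in_strip (- int (k div 2)) (int ((k + 1) div 2)) a p}"

definition line_L :: "nat \<Rightarrow> int" where
  "line_L k = (if odd k then int ((k + 1) div 2) else - int (k div 2))"

definition Free_bar :: "nat \<Rightarrow> nat \<Rightarrow> nat \<Rightarrow> (int \<times> step list) set" where
  "Free_bar m r k = {(a, p) \<in> Free m r k. touches (line_L k) a p}"

definition Free_bar_c :: "nat \<Rightarrow> nat \<Rightarrow> nat \<Rightarrow> (int \<times> step list) set" where
  "Free_bar_c m r k =
     {(a, p) \<in> Free_bar m r k.
        cornerless p \<and> (if odd m then \<not> starts_with D p else \<not> starts_with U p)}"

definition Free_c :: "nat \<Rightarrow> nat \<Rightarrow> nat \<Rightarrow> (int \<times> step list) set" where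
  "Free_c m r k = (\<Union>i \<in> {0..k}. Free_bar_c m r i)"

subsection \<open>Motzkin prefixes\<close>

definition motzkin_prefixes :: "nat \<Rightarrow> step list set" where
  "motzkin_prefixes n = {p. length p = n \<and> (\<forall>i \<le> n. 0 \<le> height 0 p i)}"

definition Pre :: "nat \<Rightarrow> nat \<Rightarrow> nat \<Rightarrow> step list set" where
  "Pre m r k = {p \<in> motzkin_prefixes (m + r). count_list p F = r \<and> in_strip 0 (int k) 0 p}"

definition Pre_bar :: "nat \<Rightarrow> nat \<Rightarrow> nat \<Rightarrow> step list set" where
  "Pre_bar m r k = {p \<in> Pre m r k. touches (int k) 0 p}"

text \<open>The path of length 0 has no last step; the requirement to end with a flat step is regarded as
  satisfied for it. This only concerns \<open>m = r = 0\<close>, where the sets in bijection with this one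
  consist of exactly one (empty) object.\<close>

definition Pre_bar_c :: "nat \<Rightarrow> nat \<Rightarrow> nat \<Rightarrow> step list set" where
  "Pre_bar_c m r k = {p \<in> Pre_bar m r k. cornerless p \<and> (p \<noteq> [] \<longrightarrow> last p = F)}"

definition Pre_c :: "nat \<Rightarrow> nat \<Rightarrow> nat \<Rightarrow> step list set" where
  "Pre_c m r k = (\<Union>i \<in> {0..k}. Pre_bar_c m r i)"

subsection \<open>Symmetric Motzkin paths\<close>

definition motzkin_paths :: "nat \<Rightarrow> step list set" where
  "motzkin_paths n =
     {p. length p = n \<and> height 0 p n = 0 \<and> (\<forall>i \<le> n. 0 \<le> height 0 p i)}"

text \<open>Length \<open>2m + t - 1\<close> with \<open>t - 1\<close> flat steps. The subtractions are truncated, which matters only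
  for \<open>t = 0\<close>: then there is no path if \<open>m > 0\<close> (without flat steps a path of odd length does not
  return to height 0), and the empty path is the only one if \<open>m = 0\<close>.\<close>

definition sym_motzkin_c :: "nat \<Rightarrow> nat \<Rightarrow> nat \<Rightarrow> step list set" where
  "sym_motzkin_c t m k =
     {p \<in> motzkin_paths (2 * m + t - 1).
        count_list p F = t - 1 \<and> symmetric_path p \<and> cornerless p \<and> in_strip 0 (int k) 0 p}"

end

theory Submission
  imports Defs "HOL-Computational_Algebra.Polynomial"
begin

text \<open>A cornerless path is monotone between consecutive flat steps, so it is determined by its end
  points and the heights of its flat steps, and its number of non-flat steps is the total variation
  of that sequence of heights. This identifies free Motzkin paths with the integer sequences, while
  the first half of a symmetric Motzkin path is a Motzkin prefix.

  Prefixes and integer sequences are compared by generating functions in \<open>q\<close>, where \<open>m\<close> is the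
  exponent. Both are entries of the \<open>s\<close>-th power of the matrix \<open>q ^ \<bar>x - y\<bar>\<close> applied to vectors \<open>q\<close> to
  the power of the distance from an interval: the whole strip for prefixes started at the bottom of
  the strip, and \<open>{0, 1}\<close> for integer sequences read backwards from \<open>0\<close>. Growing the interval and moving
  the starting point satisfy the same three-term recurrence, because the matrix commutes with a
  discrete Laplacian; hence the two can be exchanged.

  A partition \<open>\<lambda>\<close> is encoded by its beads \<open>\<lambda>\<^sub>i - i\<close>. It is self-conjugate iff \<open>x \<mapsto> - 1 - x\<close> exchanges beads and
  non-beads, a \<open>t\<close>-core iff beads are closed under subtracting \<open>t\<close>, its corners are the beads \<open>x\<close> such
  that \<open>x - 1\<close> is no bead, and \<open>h(1,1)\<close> is \<open>2 x + 1\<close> for the largest bead \<open>x\<close>. For a core, the beads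
  \<open>q * t + r\<close> in the residue class of \<open>r\<close> are those with \<open>q < n\<^sub>r\<close>, and \<open>n\<^sub>0, \<dots>, n\<^sub>s\<^sub>-\<^sub>1\<close> is the integer
  sequence; the remaining classes are determined by \<open>n\<^sub>t\<^sub>-\<^sub>1\<^sub>-\<^sub>r = - n\<^sub>r\<close>.\<close>

section \<open>Cornerless paths as sequences of flat heights\<close>

definition end_height :: "int \<Rightarrow> step list \<Rightarrow> int" where
  "end_height a p = a + sum_list (map step_rise p)"

lemma end_height_simps [simp]:
  "end_height a [] = a"
  "end_height a (x # p) = end_height (a + step_rise x) p"
  "end_height a (p @ q) = end_height (end_height a p) q"
  by (simp_all add: end_height_def)

lemma height_eq_end_height: "height a p i = end_height a (take i p)"
  by (simp add: height_def end_height_def)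

lemma height_length: "height a p (length p) = end_height a p"
  by (simp add: height_eq_end_height)

lemma in_strip_Nil [simp]: "in_strip lo hi a [] \<longleftrightarrow> lo \<le> a \<and> a \<le> hi"
  by (simp add: in_strip_def height_def)

lemma in_strip_Cons [simp]:
  "in_strip lo hi a (x # p) \<longleftrightarrow> lo \<le> a \<and> a \<le> hi \<and> in_strip lo hi (a + step_rise x) p"
  by (simp add: in_strip_def height_def less_Suc_eq_le [symmetric] All_less_Suc2
        add.assoc del: less_Suc_eq_le)

lemma in_strip_start: "in_strip lo hi a p \<Longrightarrow> lo \<le> a \<and> a \<le> hi"
  by (cases p) auto

lemma in_strip_append:
  "in_strip lo hi a (p @ q) \<longleftrightarrow> in_strip lo hi a p \<and> in_strip lo hi (end_height a p) q"
  by (induction p arbitrary: a) (auto dest: in_strip_start)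

lemma in_strip_mono:
  "in_strip lo hi a p \<Longrightarrow> lo' \<le> lo \<Longrightarrow> hi \<le> hi' \<Longrightarrow> in_strip lo' hi' a p"
  unfolding in_strip_def by fastforce

lemma cornerless_iff_successively:
  "cornerless p \<longleftrightarrow> successively (\<lambda>x y. \<not> (x = U \<and> y = D) \<and> \<not> (x = D \<and> y = U)) p"
  by (auto simp: cornerless_def successively_conv_nth)

lemma cornerless_Nil [simp]: "cornerless []"
  by (simp add: cornerless_def)

lemma cornerless_Cons:
  "cornerless (x # p) \<longleftrightarrow>
     cornerless p \<and> \<not> (x = U \<and> starts_with D p) \<and> \<not> (x = D \<and> starts_with U p)"
  by (auto simp: cornerless_iff_successively successively_Cons starts_with_def)

lemma starts_with_simps [simp]: "\<not> starts_with x []" "starts_with x (y # p) \<longleftrightarrow> x = y"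
  by (auto simp: starts_with_def)

definition vert :: "int \<Rightarrow> step list" where
  "vert d = (if 0 \<le> d then replicate (nat d) U else replicate (nat (- d)) D)"

lemma vert_0 [simp]: "vert 0 = []"
  by (simp add: vert_def)

lemma vert_pos: "0 < d \<Longrightarrow> vert d = U # vert (d - 1)"
  by (cases "nat d") (auto simp: vert_def nat_diff_distrib)

lemma vert_neg: "d < 0 \<Longrightarrow> vert d = D # vert (d + 1)"
  by (cases "nat (- d)") (auto simp: vert_def nat_diff_distrib)

lemma vert_induct [case_names zero pos neg]:
  assumes "P 0" "\<And>d. 0 < d \<Longrightarrow> P (d - 1) \<Longrightarrow> P d" "\<And>d. d < 0 \<Longrightarrow> P (d + 1) \<Longrightarrow> P d"
  shows "P (d :: int)"
proof (induction "nat \<bar>d\<bar>" arbitrary: d)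
  case (Suc n)
  then consider "0 < d" "P (d - 1)" | "d < 0" "P (d + 1)"
    by (cases d "0::int" rule: linorder_cases) auto
  then show ?case using assms(2,3)[of d] by cases auto
qed (simp add: assms)

lemma length_vert [simp]: "length (vert d) = nat \<bar>d\<bar>"
  by (simp add: vert_def)

lemma end_height_vert [simp]: "end_height a (vert d) = a + d"
  by (simp add: end_height_def vert_def sum_list_replicate)

lemma count_vert [simp]: "count_list (vert d) F = 0"
  by (simp add: vert_def)

lemma in_strip_vert [simp]:
  "in_strip lo hi a (vert d) \<longleftrightarrow> lo \<le> a \<and> a \<le> hi \<and> lo \<le> a + d \<and> a + d \<le> hi"
proof (induction d arbitrary: a rule: vert_induct)
  case (pos d)
  then show ?case by (simp add: vert_pos [OF pos(1)]) arith
next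
  case (neg d)
  then show ?case by (simp add: vert_neg [OF neg(1)]) arith
qed auto

text \<open>The cornerless path from height \<open>a\<close> to height \<open>e\<close> whose flat steps have heights \<open>hs\<close>; between
  two flat steps it is forced to be monotone.\<close>

fun enc :: "int \<Rightarrow> int list \<Rightarrow> int \<Rightarrow> step list" where
  "enc a [] e = vert (e - a)"
| "enc a (h # hs) e = vert (h - a) @ F # enc h hs e"

fun flats :: "int \<Rightarrow> step list \<Rightarrow> int list" where
  "flats a [] = []"
| "flats a (x # p) = (if x = F then [a] else []) @ flats (a + step_rise x) p"

fun tv :: "int \<Rightarrow> int list \<Rightarrow> int \<Rightarrow> int" where
  "tv a [] e = \<bar>e - a\<bar>"
| "tv a (h # hs) e = \<bar>h - a\<bar> + tv h hs e"

lemma tv_nonneg: "0 \<le> tv a hs e"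
  by (induction hs arbitrary: a) auto

lemma tv_append: "tv a (xs @ y # ys) e = tv a xs y + tv y ys e"
  by (induction xs arbitrary: a) auto

lemma tv_rev: "tv a (rev hs) e = tv e hs a"
  by (induction hs arbitrary: e) (auto simp: tv_append)

lemma tv_uminus: "tv a (map uminus xs) e = tv (- a) xs (- e)"
  by (induction xs arbitrary: a) auto

lemma int_length_enc: "int (length (enc a hs e)) = int (length hs) + tv a hs e"
  by (induction hs arbitrary: a) auto

lemma end_height_enc [simp]: "end_height a (enc a hs e) = e"
  by (induction hs arbitrary: a) auto

lemma count_enc [simp]: "count_list (enc a hs e) F = length hs"
  by (induction hs arbitrary: a) auto

lemma in_strip_enc:
  "in_strip lo hi a (enc a hs e) \<longleftrightarrow> a \<in> {lo..hi} \<and> e \<in> {lo..hi} \<and> set hs \<subseteq> {lo..hi}"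
  by (induction hs arbitrary: a) (auto simp: in_strip_append)

lemma flats_vert_append: "flats a (vert d @ p) = flats (a + d) p"
  by (induction d arbitrary: a rule: vert_induct) (auto simp: vert_pos vert_neg)

lemma flats_enc [simp]: "flats a (enc a hs e) = hs"
  using flats_vert_append[of a "e - a" "[]" for a]
  by (induction hs arbitrary: a) (auto simp: flats_vert_append)

lemma starts_with_vert_append:
  "starts_with x (vert d @ p) \<longleftrightarrow> (if d = 0 then starts_with x p else x = (if 0 < d then U else D))"
  by (cases d "0::int" rule: linorder_cases) (auto simp: vert_pos vert_neg)

lemma starts_with_enc:
  "starts_with U (enc a hs e) \<longleftrightarrow> a < hd (hs @ [e])"
  "starts_with D (enc a hs e) \<longleftrightarrow> hd (hs @ [e]) < a"
  using starts_with_vert_append[of U "e - a" "[]"] starts_with_vert_append[of D "e - a" "[]"]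
  by (cases hs; auto simp: starts_with_vert_append)+

lemma cornerless_vert_F: "cornerless p \<Longrightarrow> cornerless (vert d @ F # p)"
proof (induction d rule: vert_induct)
  case (pos d)
  then show ?case by (auto simp: vert_pos cornerless_Cons starts_with_vert_append)
next
  case (neg d)
  then show ?case by (auto simp: vert_neg cornerless_Cons starts_with_vert_append)
qed (simp add: cornerless_Cons)

lemma cornerless_vert: "cornerless (vert d)"
  by (induction d rule: vert_induct)
     (auto simp: vert_pos vert_neg cornerless_Cons
        starts_with_vert_append[where p = "[]", simplified])

lemma cornerless_enc [simp]: "cornerless (enc a hs e)"
  by (induction hs arbitrary: a) (auto simp: cornerless_vert cornerless_vert_F)

lemma enc_up: "a < hd (hs @ [e]) \<Longrightarrow> enc a hs e = U # enc (a + 1) hs e"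
  by (cases hs) (auto simp: vert_pos algebra_simps)

lemma enc_down: "hd (hs @ [e]) < a \<Longrightarrow> enc a hs e = D # enc (a - 1) hs e"
  by (cases hs) (auto simp: vert_neg algebra_simps)

text \<open>Cornerlessness forces the first step: an up step cannot precede a path that sets out
  downwards, nor a down step one that sets out upwards. Hence \<open>enc\<close> prepends exactly
  this step to the path reconstructed by the induction hypothesis.\<close>

lemma enc_flats: "cornerless p \<Longrightarrow> enc a (flats a p) (end_height a p) = p"
proof (induction p arbitrary: a)
  case (Cons x p)
  have IH: "enc (a + step_rise x) (flats (a + step_rise x) p) (end_height (a + step_rise x) p) = p"
    using Cons by (auto simp: cornerless_Cons)
  \<comment> \<open>\<open>?t\<close> is the height for which the remaining path heads: that of its
    next flat step, or its end height if no flat step is left.\<close>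
  let ?t = "hd (flats (a + step_rise x) p @ [end_height (a + step_rise x) p])"
  have "\<not> (x = U \<and> ?t < a + 1)" "\<not> (x = D \<and> a - 1 < ?t)"
    using Cons.prems starts_with_enc[of "a + step_rise x" "flats (a + step_rise x) p"
        "end_height (a + step_rise x) p"]
    unfolding IH cornerless_Cons by auto
  then show ?case
    using IH by (cases x) (auto simp: enc_up enc_down)
qed auto

lemma length_flats [simp]: "length (flats a p) = count_list p F"
  by (induction p arbitrary: a) auto

lemma flats_snoc_F: "flats a (p @ [F]) = flats a p @ [end_height a p]"
  by (induction p arbitrary: a) auto

text \<open>Ending at the last flat height leaves no vertical run after the last flat step. The
  \<open>a\<close> in \<open>last (a # hs)\<close> is the end height when there are no flat
  steps.\<close>

lemma last_enc:
  "enc a hs (last (a # hs)) \<noteq> [] \<Longrightarrow> last (enc a hs (last (a # hs))) = F"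
proof (induction hs arbitrary: a)
  case (Cons h hs)
  have "last (h # hs) = last (a # h # hs)" by simp
  then show ?case using Cons.IH[of h]
    by (cases "enc h hs (last (h # hs)) = []") auto
qed simp

section \<open>Integer sequences, free Motzkin paths and Motzkin prefixes\<close>

definition lists_between :: "int \<Rightarrow> int \<Rightarrow> nat \<Rightarrow> int list set" where
  "lists_between lo hi s = {xs. length xs = s \<and> set xs \<subseteq> {lo..hi}}"

lemma finite_lists_between [simp]: "finite (lists_between lo hi s)"
  using finite_lists_length_eq[of "{lo..hi}" s] by (simp add: lists_between_def conj_commute)

lemma lists_between_0 [simp]: "lists_between lo hi 0 = {[]}"
  by (auto simp: lists_between_def)

lemma sum_lists_between_Suc:
  "sum f (lists_between lo hi (Suc s)) =
     (\<Sum>y\<in>{lo..hi}. \<Sum>ys\<in>lists_between lo hi s. f (y # ys))"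
proof -
  have "sum f (lists_between lo hi (Suc s)) =
      (\<Sum>(y, ys)\<in>{lo..hi} \<times> lists_between lo hi s. f (y # ys))"
    by (rule sum.reindex_bij_witness[of _ "\<lambda>(y, ys). y # ys" "\<lambda>xs. (hd xs, tl xs)"])
       (auto simp: lists_between_def length_Suc_conv)
  then show ?thesis by (simp add: sum.cartesian_product)
qed

lemma sum_telescope_list:
  "(\<Sum>i\<le>length hs. \<bar>(a # hs @ [e]) ! Suc i - (a # hs @ [e]) ! i\<bar>) = tv a hs e"
  by (induction hs arbitrary: a) (simp_all add: sum.atMost_Suc_shift del: sum.atMost_Suc)

lemma seq_ext_pred: "i \<le> Suc (length ns) \<Longrightarrow> seq_ext ns (int i - 1) = (0 # ns @ [0]) ! i"
  by (cases i) (auto simp: seq_ext_def nth_append)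

lemma sum_seq_ext:
  "(\<Sum>i = 0..int (length ns). \<bar>seq_ext ns i - seq_ext ns (i - 1)\<bar>) = tv 0 ns 0"
proof -
  have "(\<Sum>i = 0..int (length ns). \<bar>seq_ext ns i - seq_ext ns (i - 1)\<bar>) =
      (\<Sum>i\<le>length ns. \<bar>(0 # ns @ [0]) ! Suc i - (0 # ns @ [0]) ! i\<bar>)"
  proof (rule sum.reindex_bij_witness[of _ int nat])
    fix i assume i: "i \<in> {0..int (length ns)}"
    have "seq_ext ns i = (0 # ns @ [0]) ! Suc (nat i)" "seq_ext ns (i - 1) = (0 # ns @ [0]) ! nat i"
      using seq_ext_pred[of "nat i" ns] seq_ext_pred[of "Suc (nat i)" ns] i by auto
    then show "\<bar>(0 # ns @ [0]) ! Suc (nat i) - (0 # ns @ [0]) ! nat i\<bar> =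
        \<bar>seq_ext ns i - seq_ext ns (i - 1)\<bar>"
      by simp
  qed auto
  then show ?thesis using sum_telescope_list[of 0 ns 0] by simp
qed

lemma even_tv: "even (tv a hs e + a + e)"
proof (induction hs arbitrary: a)
  case (Cons h hs)
  then show ?case using Cons[of h] by auto
qed auto

lemma seq_ext_0: "seq_ext ns 0 = hd (ns @ [0])"
  by (cases ns) (auto simp: seq_ext_def)

text \<open>Subtracting 1 for a positive first entry merges the two cases of
  \<open>core_sequences\<close>: by \<open>cost_parity\<close>, the equation
  \<open>cost ns = int m\<close> already implies the sign condition. The appended 0 stands for the
  first entry when the sequence is empty.\<close>

definition cost :: "int list \<Rightarrow> int" where
  "cost ns = tv 0 ns 0 - (if 0 < hd (ns @ [0]) then 1 else 0)"

lemma cost_parity: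
  assumes "cost ns = int m"
  shows "odd m \<longleftrightarrow> 0 < hd (ns @ [0])"
proof -
  have "tv 0 ns 0 = int (m + (if 0 < hd (ns @ [0]) then 1 else 0))"
    using assms by (auto simp: cost_def)
  then have "even (m + (if 0 < hd (ns @ [0]) then 1 else 0))"
    using even_tv[of 0 ns 0] by (metis add_0_right even_of_nat)
  then show ?thesis by (auto split: if_splits)
qed

lemma core_sequences_eq:
  "core_sequences s m k =
     {ns \<in> lists_between (- int (k div 2)) (int ((k + 1) div 2)) s. cost ns = int m}"
proof -
  have *: "(if odd m then 0 < seq_ext ns 0 else seq_ext ns 0 \<le> 0) \<and>
      tv 0 ns 0 = (if odd m then int m + 1 else int m) \<longleftrightarrow> cost ns = int m" for ns
    using cost_parity[of ns m] by (auto simp: cost_def seq_ext_0)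
  show ?thesis
  proof (rule set_eqI)
    fix ns
    show "ns \<in> core_sequences s m k \<longleftrightarrow>
        ns \<in> {ns \<in> lists_between (- int (k div 2)) (int ((k + 1) div 2)) s. cost ns = int m}"
      using *[of ns] sum_seq_ext[of ns]
      by (cases "length ns = s") (auto simp: core_sequences_def lists_between_def subset_eq)
  qed
qed

text \<open>Starting at height 1 instead of 0 saves one unit of variation exactly when the first
  target is positive, which is the correction in \<open>cost\<close>.\<close>

lemma cost_eq_tv: "odd m \<longleftrightarrow> 0 < hd (ns @ [0]) \<Longrightarrow> cost ns = tv (int (m mod 2)) ns 0"
  by (cases ns) (auto simp: cost_def parity_cases odd_iff_mod_2_eq_one)

section \<open>Free Motzkin paths in the full strip\<close>

lemma Free_c_eq:
  "Free_c m r k = {(a, p) \<in> free_motzkin_paths (m + r).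
     count_list p F = r \<and> in_strip (- int (k div 2)) (int ((k + 1) div 2)) a p \<and>
     cornerless p \<and> (if odd m then \<not> starts_with D p else \<not> starts_with U p)}"
  (is "_ = ?R")
proof
  show "Free_c m r k \<subseteq> ?R"
    unfolding Free_c_def Free_bar_c_def Free_bar_def Free_def
    by (auto elim!: in_strip_mono intro!: div_le_mono)
next
  let ?S = "\<lambda>i. in_strip (- int (i div 2)) (int ((i + 1) div 2))"
  \<comment> \<open>The strips for \<open>k\<close> and \<open>Suc k\<close> differ only in the line
    \<open>line_L (Suc k)\<close>, so a path touches that line or stays in the smaller strip; for
    \<open>k = 0\<close> the strip is the line itself.\<close>
  have *: "\<exists>i\<le>k. ?S i a p \<and> touches (line_L i) a p" if "?S k a p" for a p
    using that
  proof (induction k)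
    case 0
    then show ?case by (force simp: touches_def line_L_def in_strip_def)
  next
    case (Suc k)
    show ?case
    proof (cases "touches (line_L (Suc k)) a p")
      case True
      then show ?thesis using Suc.prems by blast
    next
      case False
      have "?S k a p"
        unfolding in_strip_def
      proof (intro allI impI)
        fix i assume i: "i \<le> length p"
        have "- int (Suc k div 2) \<le> height a p i" "height a p i \<le> int ((Suc k + 1) div 2)"
          "height a p i \<noteq> line_L (Suc k)"
          using Suc.prems False i unfolding in_strip_def touches_def by auto
        then show "- int (k div 2) \<le> height a p i \<and> height a p i \<le> int ((k + 1) div 2)"
          by (cases "even k") (auto simp: line_L_def elim!: evenE oddE)
      qed
      then show ?thesis using Suc.IH by (meson le_Suc_eq)
    qed
  qed
  show "?R \<subseteq> Free_c m r k"
    unfolding Free_c_def Free_bar_c_def Free_bar_def Free_def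
    using * by fastforce
qed

lemma even_length_end_height:
  "even (int (length p) - int (count_list p F) + a + end_height a p)"
proof (induction p arbitrary: a)
  case (Cons x p)
  then show ?case using Cons[of "a + step_rise x"] by (cases x) auto
qed simp

lemma core_sequences_eqpoll_Free_c: "core_sequences s m k \<approx> Free_c m s k"
proof -
  let ?a = "int (m mod 2)"
  \<comment> \<open>For odd \<open>m\<close> the path starts at 1, and not starting down means a
    first target of at least 1; for even \<open>m\<close> it starts at 0, and not starting up means
    a first target of at most 0.\<close>
  have sw: "(if odd m then \<not> starts_with D (enc ?a ns 0) else \<not> starts_with U (enc ?a ns 0)) \<longleftrightarrow>
      (odd m \<longleftrightarrow> 0 < hd (ns @ [0]))" for ns
    by (auto simp: starts_with_enc odd_iff_mod_2_eq_one)
  have hd_in: "ns \<in> lists_between lo hi s \<Longrightarrow> 0 < hd (ns @ [0]) \<Longrightarrow> 1 \<le> hi" for lo hi ns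
    by (cases ns) (auto simp: lists_between_def)
  have "bij_betw (\<lambda>ns. (?a, enc ?a ns 0)) (core_sequences s m k) (Free_c m s k)"
  proof (rule bij_betw_byWitness[where f' = "\<lambda>(a, p). flats a p"])
    show "(\<lambda>ns. (?a, enc ?a ns 0)) ` core_sequences s m k \<subseteq> Free_c m s k"
    proof clarify
      fix ns assume "ns \<in> core_sequences s m k"
      then have ns: "ns \<in> lists_between (- int (k div 2)) (int ((k + 1) div 2)) s" "cost ns = int m"
        by (auto simp: core_sequences_eq)
      have len: "length (enc ?a ns 0) = m + s"
        using int_length_enc[of ?a ns 0] cost_eq_tv[OF cost_parity[OF ns(2)]] ns
        by (auto simp: lists_between_def)
      have "in_strip (- int (k div 2)) (int ((k + 1) div 2)) ?a (enc ?a ns 0)"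
        using hd_in[OF ns(1)] cost_parity[OF ns(2)] ns(1)
        by (auto simp: in_strip_enc lists_between_def odd_iff_mod_2_eq_one)
      then show "(?a, enc ?a ns 0) \<in> Free_c m s k"
        using sw[of ns] cost_parity[OF ns(2)] len ns(1) height_length[of ?a "enc ?a ns 0"]
        unfolding Free_c_eq
        by (auto simp: free_motzkin_paths_def lists_between_def)
    qed
  next
    have conv: "enc ?a (flats a p) 0 = p \<and> a = ?a \<and> flats a p \<in> core_sequences s m k"
      if "(a, p) \<in> Free_c m s k" for a p
    proof -
      from that have a: "a \<in> {0, 1}" and len: "length p = m + s" and e: "end_height a p = 0"
        and c: "count_list p F = s" and cl: "cornerless p"
        and str: "in_strip (- int (k div 2)) (int ((k + 1) div 2)) a p"
        and st: "(if odd m then \<not> starts_with D p else \<not> starts_with U p)"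
        using height_length[of a p] unfolding Free_c_eq free_motzkin_paths_def by auto
      have "even (int m + a)"
        using even_length_end_height[of p a] len c e by simp
      then have aa: "a = ?a" using a by (auto simp: odd_iff_mod_2_eq_one)
      have enc: "enc a (flats a p) 0 = p" using enc_flats[OF cl, of a] e by simp
      have "if odd m then \<not> starts_with D (enc ?a (flats a p) 0)
          else \<not> starts_with U (enc ?a (flats a p) 0)"
        using st enc unfolding aa [symmetric] by simp
      then have "odd m \<longleftrightarrow> 0 < hd (flats a p @ [0])"
        by (simp only: sw)
      then have "cost (flats a p) = tv a (flats a p) 0"
        using cost_eq_tv aa by blast
      also have "\<dots> = int m"
        using int_length_enc[of a "flats a p" 0] enc len c by simp
      finally have "flats a p \<in> core_sequences s m k"
        using in_strip_enc[of _ _ a "flats a p" 0] str enc c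
        by (simp add: core_sequences_eq lists_between_def)
      then show ?thesis using enc aa by simp
    qed
    show "\<forall>ap\<in>Free_c m s k. (?a, enc ?a (case ap of (a, p) \<Rightarrow> flats a p) 0) = ap"
      using conv by auto
    show "(\<lambda>(a, p). flats a p) ` Free_c m s k \<subseteq> core_sequences s m k"
      using conv by auto
  qed simp
  then show ?thesis by (auto simp: eqpoll_def)
qed

section \<open>Motzkin prefixes ending with a flat step\<close>

lemma Pre_c_eq:
  "Pre_c m r k = {p. length p = m + r \<and> count_list p F = r \<and> in_strip 0 (int k) 0 p \<and>
     cornerless p \<and> (p \<noteq> [] \<longrightarrow> last p = F)}"
  (is "_ = ?R")
proof
  show "Pre_c m r k \<subseteq> ?R"
    unfolding Pre_c_def Pre_bar_c_def Pre_bar_def Pre_def motzkin_prefixes_def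
    by (auto elim!: in_strip_mono)
next
  have *: "\<exists>i\<le>k. in_strip 0 (int i) 0 p \<and> touches (int i) 0 p" if "in_strip 0 (int k) 0 p" for p
    using that
  proof (induction k)
    case 0
    then show ?case by (force simp: touches_def in_strip_def)
  next
    case (Suc k)
    show ?case
    proof (cases "touches (int (Suc k)) 0 p")
      case True
      then show ?thesis using Suc.prems by blast
    next
      case False
      have "in_strip 0 (int k) 0 p"
        using Suc.prems False unfolding in_strip_def touches_def by force
      then show ?thesis using Suc.IH by (meson le_Suc_eq)
    qed
  qed
  show "?R \<subseteq> Pre_c m r k"
  proof
    fix p assume p: "p \<in> ?R"
    then obtain i where "i \<le> k" "in_strip 0 (int i) 0 p" "touches (int i) 0 p"
      using * by blast
    then show "p \<in> Pre_c m r k"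
      using p unfolding Pre_c_def Pre_bar_c_def Pre_bar_def Pre_def motzkin_prefixes_def
      by (auto simp: in_strip_def)
  qed
qed

definition prefix_cost :: "int \<Rightarrow> int list \<Rightarrow> int" where
  "prefix_cost a hs = tv a hs (last (a # hs))"

lemma prefix_lists_eqpoll_Pre_c:
  "{hs \<in> lists_between 0 (int k) s. prefix_cost 0 hs = int m} \<approx> Pre_c m s k" (is "?A \<approx> _")
proof -
  let ?e = "\<lambda>hs. enc 0 hs (last (0 # hs))"
  have "bij_betw ?e ?A (Pre_c m s k)"
  proof (rule bij_betw_byWitness[where f' = "flats 0"])
    show "?e ` ?A \<subseteq> Pre_c m s k"
    proof clarify
      fix hs assume hs: "hs \<in> lists_between 0 (int k) s" "prefix_cost 0 hs = int m"
      have "length (?e hs) = m + s"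
        using int_length_enc[of 0 hs "last (0 # hs)"] hs
        by (auto simp: lists_between_def prefix_cost_def)
      moreover have "in_strip 0 (int k) 0 (?e hs)"
        using hs(1) last_in_set[of hs]
        by (auto simp: in_strip_enc lists_between_def simp del: last_in_set)
      ultimately show "?e hs \<in> Pre_c m s k"
        using last_enc[of 0 hs] hs(1) unfolding Pre_c_eq lists_between_def by auto
    qed
  next
    have conv: "?e (flats 0 p) = p \<and> flats 0 p \<in> ?A" if "p \<in> Pre_c m s k" for p
    proof -
      from that have len: "length p = m + s" and c: "count_list p F = s"
        and cl: "cornerless p" and str: "in_strip 0 (int k) 0 p"
        and l: "p \<noteq> [] \<longrightarrow> last p = F"
        unfolding Pre_c_eq by auto
      have "last (0 # flats 0 p) = end_height 0 p"
        using l by (cases p rule: rev_cases) (auto simp: flats_snoc_F)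
      then have enc: "?e (flats 0 p) = p" using enc_flats[OF cl, of 0] by metis
      moreover have "prefix_cost 0 (flats 0 p) = int m"
        using int_length_enc[of 0 "flats 0 p" "last (0 # flats 0 p)"] len c
        unfolding enc prefix_cost_def by simp
      moreover have "flats 0 p \<in> lists_between 0 (int k) s"
        using in_strip_enc[of 0 "int k" 0 "flats 0 p" "last (0 # flats 0 p)"] str c
        unfolding enc by (simp add: lists_between_def)
      ultimately show ?thesis by simp
    qed
    show "\<forall>p\<in>Pre_c m s k. ?e (flats 0 p) = p" "flats 0 ` Pre_c m s k \<subseteq> ?A"
      using conv by auto
  qed simp
  then show ?thesis by (auto simp: eqpoll_def)
qed

section \<open>Symmetric Motzkin paths\<close>

lemma step_bar_step_bar [simp]: "step_bar (step_bar x) = x"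
  by (cases x) auto

lemma map_step_bar_map_step_bar [simp]: "map step_bar (map step_bar p) = p"
  by (simp add: map_idI)

lemma step_bar_eq [simp]: "step_bar x = F \<longleftrightarrow> x = F" "step_bar x = U \<longleftrightarrow> x = D"
  "step_bar x = D \<longleftrightarrow> x = U" "step_bar x = x \<longleftrightarrow> x = F"
  by (cases x; simp)+

lemma symmetric_path_iff: "symmetric_path p \<longleftrightarrow> rev p = map step_bar p"
  by (auto simp: symmetric_path_def list_eq_iff_nth_eq rev_nth)

abbreviation (input) mirror :: "step list \<Rightarrow> step list" where
  "mirror p \<equiv> map step_bar (rev p)"

lemma end_height_mirror [simp]: "end_height (end_height a p) (mirror p) = a"
proof (induction p arbitrary: a)
  case (Cons x p)
  then show ?case by (cases x) auto
qed simp

lemma in_strip_mirror [simp]: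
  "in_strip lo hi (end_height a p) (mirror p) \<longleftrightarrow> in_strip lo hi a p"
proof (induction p arbitrary: a)
  case (Cons x p)
  have *: "a + step_rise x + step_rise (step_bar x) = a" by (cases x) auto
  show ?case using Cons[of "a + step_rise x"] in_strip_start[of lo hi "a + step_rise x" p]
    by (auto simp: in_strip_append *)
qed simp

lemma count_mirror [simp]: "count_list (mirror p) F = count_list p F"
  by (induction p) auto

lemma cornerless_append:
  "cornerless (p @ q) \<longleftrightarrow> cornerless p \<and> cornerless q \<and>
     (p \<noteq> [] \<and> q \<noteq> [] \<longrightarrow> \<not> (last p = U \<and> hd q = D) \<and> \<not> (last p = D \<and> hd q = U))"
  by (auto simp: cornerless_iff_successively successively_append_iff)

lemma cornerless_mirror [simp]: "cornerless (mirror p) \<longleftrightarrow> cornerless p"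
  by (auto simp: cornerless_iff_successively successively_map elim!: successively_mono)

text \<open>At the junction a step meets its own reversal, which is a corner unless the step is
  flat.\<close>

lemma cornerless_append_mirror:
  "cornerless (p @ mirror p) \<longleftrightarrow> cornerless p \<and> (p \<noteq> [] \<longrightarrow> last p = F)"
  by (cases "last p") (auto simp: cornerless_append hd_map hd_rev)

lemma sym_motzkin_c_eq:
  "sym_motzkin_c t m k = {p. length p = 2 * m + t - 1 \<and> end_height 0 p = 0 \<and>
     count_list p F = t - 1 \<and> rev p = map step_bar p \<and> cornerless p \<and> in_strip 0 (int k) 0 p}"
proof -
  have "in_strip 0 (int k) 0 p \<Longrightarrow> i \<le> length p \<Longrightarrow> 0 \<le> height 0 p i" for p i
    by (auto simp: in_strip_def)
  then show ?thesis
    unfolding sym_motzkin_c_def motzkin_paths_def symmetric_path_iff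
    by (auto simp: height_length[symmetric])
qed

text \<open>Here the length \<open>2 * (m + s)\<close> is even, so a symmetric path is a prefix
  followed by its mirror image. The mirror image retraces the heights, which settles the strip and
  the end point.\<close>

lemma Pre_c_eqpoll_sym_odd: "Pre_c m s k \<approx> sym_motzkin_c (2 * s + 1) m k"
proof -
  have "bij_betw (\<lambda>p. p @ mirror p) (Pre_c m s k) (sym_motzkin_c (2 * s + 1) m k)"
  proof (rule bij_betw_byWitness[where f' = "take (m + s)"])
    show "\<forall>p\<in>Pre_c m s k. take (m + s) (p @ mirror p) = p"
      by (auto simp: Pre_c_eq)
    show "(\<lambda>p. p @ mirror p) ` Pre_c m s k \<subseteq> sym_motzkin_c (2 * s + 1) m k"
      by (auto simp: Pre_c_eq sym_motzkin_c_eq rev_map map_idI cornerless_append_mirror in_strip_append)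
    have conv: "take (m + s) p @ mirror (take (m + s) p) = p \<and> take (m + s) p \<in> Pre_c m s k"
      if p: "p \<in> sym_motzkin_c (2 * s + 1) m k" for p
    proof -
      define h g where "h = take (m + s) p" and "g = drop (m + s) p"
      have hg: "p = h @ g" by (simp add: h_def g_def)
      have len: "length p = 2 * (m + s)" "length h = m + s" "length g = m + s"
        using p by (auto simp: sym_motzkin_c_eq h_def g_def)
      have "rev p = map step_bar p" using p by (simp add: sym_motzkin_c_eq)
      then have "map step_bar g = rev h"
        unfolding hg using len by simp
      then have "mirror h = g" by (metis map_step_bar_map_step_bar)
      then have "p = h @ mirror h" using hg by simp
      moreover have "h \<in> Pre_c m s k"
        using p len unfolding calculation
        by (auto simp: Pre_c_eq sym_motzkin_c_eq cornerless_append_mirror in_strip_append)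
      ultimately show ?thesis by (simp add: h_def)
    qed
    then show "\<forall>p\<in>sym_motzkin_c (2 * s + 1) m k. take (m + s) p @ mirror (take (m + s) p) = p"
      "take (m + s) ` sym_motzkin_c (2 * s + 1) m k \<subseteq> Pre_c m s k"
      by auto
  qed
  then show ?thesis by (auto simp: eqpoll_def)
qed

text \<open>Here the length is odd, and the middle step is fixed by \<open>step_bar\<close>, hence
  flat. It is the final flat step of the prefix and occurs only once in the symmetric path, which
  gives \<open>2 * s - 1\<close> flat steps.\<close>

lemma Pre_c_eqpoll_sym_even:
  assumes "0 < s"
  shows "Pre_c m s k \<approx> sym_motzkin_c (2 * s) m k"
proof -
  define n where "n = m + s - 1"
  have snoc: "\<exists>q. p = q @ [F]" if "p \<in> Pre_c m s k" for p
    using that assms by (cases p rule: rev_cases) (auto simp: Pre_c_eq)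
  have corner: "cornerless (q @ F # mirror q) \<longleftrightarrow> cornerless q" for q
    by (simp add: cornerless_append cornerless_Cons starts_with_def)
  have snoc_F: "cornerless (q @ [F]) \<longleftrightarrow> cornerless q" for q
    by (simp add: cornerless_append cornerless_Cons)
  have in_sym: "q @ F # mirror q \<in> sym_motzkin_c (2 * s) m k \<longleftrightarrow> q @ [F] \<in> Pre_c m s k" for q
    using assms in_strip_start[of 0 "int k" "end_height 0 q" "mirror q"]
    by (auto simp: Pre_c_eq sym_motzkin_c_eq rev_map map_idI corner snoc_F in_strip_append)
  have "bij_betw (\<lambda>p. butlast p @ F # mirror (butlast p)) (Pre_c m s k) (sym_motzkin_c (2 * s) m k)"
  proof (rule bij_betw_byWitness[where f' = "\<lambda>p. take n p @ [F]"])
    show "\<forall>p\<in>Pre_c m s k. take n (butlast p @ F # mirror (butlast p)) @ [F] = p"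
      using snoc by (fastforce simp: Pre_c_eq n_def)
    show "(\<lambda>p. butlast p @ F # mirror (butlast p)) ` Pre_c m s k \<subseteq> sym_motzkin_c (2 * s) m k"
      using snoc in_sym by fastforce
    have conv: "take n p @ F # mirror (take n p) = p \<and> take n p @ [F] \<in> Pre_c m s k"
      if p: "p \<in> sym_motzkin_c (2 * s) m k" for p
    proof -
      define h x g where "h = take n p" and "x = p ! n" and "g = drop (Suc n) p"
      have "length p = Suc (2 * n)" using p assms by (auto simp: sym_motzkin_c_eq n_def)
      then have hg: "p = h @ x # g" and len: "length h = n" "length g = n"
        by (simp_all add: h_def g_def x_def id_take_nth_drop[symmetric])
      have "rev p = map step_bar p" using p by (simp add: sym_motzkin_c_eq)
      then have "map step_bar g = rev h" "step_bar x = x"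
        unfolding hg using len by simp_all
      then have "mirror h = g" "x = F"
        by (metis map_step_bar_map_step_bar) (use \<open>step_bar x = x\<close> in simp)
      then have "p = h @ F # mirror h" using hg by simp
      then show ?thesis using in_sym[of h] p by (simp add: h_def)
    qed
    then show "\<forall>p\<in>sym_motzkin_c (2 * s) m k.
        butlast (take n p @ [F]) @ F # mirror (butlast (take n p @ [F])) = p"
      "(\<lambda>p. take n p @ [F]) ` sym_motzkin_c (2 * s) m k \<subseteq> Pre_c m s k"
      by auto
  qed
  then show ?thesis by (auto simp: eqpoll_def)
qed

lemma Pre_c_0: "Pre_c m 0 k = (if m = 0 then {[]} else {})"
proof -
  have "p = []" if "p \<in> Pre_c m 0 k" for p
    using that by (cases p rule: rev_cases) (auto simp: Pre_c_eq)
  moreover have "[] \<in> Pre_c m 0 k \<longleftrightarrow> m = 0"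
    by (auto simp: Pre_c_eq)
  ultimately show ?thesis by auto
qed

lemma sym_motzkin_c_0: "sym_motzkin_c 0 m k = (if m = 0 then {[]} else {})"
proof -
  have "m = 0" if p: "p \<in> sym_motzkin_c 0 m k" for p
    using even_length_end_height[of p 0] p by (cases m) (auto simp: sym_motzkin_c_eq)
  then show ?thesis by (auto simp: sym_motzkin_c_eq)
qed

lemma Pre_c_eqpoll_sym_motzkin_c: "Pre_c m (t div 2) k \<approx> sym_motzkin_c t m k"
proof (cases "even t")
  case True
  then show ?thesis
    using Pre_c_eqpoll_sym_even[of "t div 2" m k]
    by (cases "t = 0") (auto simp: Pre_c_0 sym_motzkin_c_0)
next
  case False
  then show ?thesis
    using Pre_c_eqpoll_sym_odd[of m "t div 2" k] by simp
qed

section \<open>Generating functions by total variation\<close>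

text \<open>The \<open>s\<close>-th power of the matrix \<open>q ^ nat \<bar>y - x\<bar>\<close> on
  \<open>{lo..hi}\<close>, applied to \<open>f\<close>. The argument \<open>x\<close> may lie
  outside the interval, so that boundary conditions can be stated one step beyond it.\<close>

fun transfer :: "'a::comm_ring_1 \<Rightarrow> int \<Rightarrow> int \<Rightarrow> nat \<Rightarrow> (int \<Rightarrow> 'a) \<Rightarrow> int \<Rightarrow> 'a" where
  "transfer q lo hi 0 f x = f x"
| "transfer q lo hi (Suc s) f x =
     (\<Sum>y\<in>{lo..hi}. q ^ nat \<bar>y - x\<bar> * transfer q lo hi s f y)"

lemma prefix_cost_simps [simp]:
  "prefix_cost a [] = 0" "prefix_cost a (h # hs) = \<bar>h - a\<bar> + prefix_cost h hs"
  by (simp_all add: prefix_cost_def)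

lemma tv_eq_prefix_cost: "tv a hs e = prefix_cost a hs + \<bar>e - last (a # hs)\<bar>"
  by (induction hs arbitrary: a) auto

lemma prefix_cost_nonneg: "0 \<le> prefix_cost a hs"
  by (simp add: prefix_cost_def tv_nonneg)

lemma sum_prefix_cost:
  "(\<Sum>hs\<in>lists_between lo hi s. q ^ nat (prefix_cost x hs) * f (last (x # hs))) =
     transfer q lo hi s f x"
proof (induction s arbitrary: x)
  case (Suc s)
  have "(\<Sum>hs\<in>lists_between lo hi (Suc s). q ^ nat (prefix_cost x hs) * f (last (x # hs))) =
      (\<Sum>y\<in>{lo..hi}. \<Sum>hs\<in>lists_between lo hi s.
         q ^ nat \<bar>y - x\<bar> * (q ^ nat (prefix_cost y hs) * f (last (y # hs))))"
    unfolding sum_lists_between_Suc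
    by (intro sum.cong)
       (simp_all add: nat_add_distrib prefix_cost_nonneg power_add mult.assoc)
  then show ?case by (simp only: sum_distrib_left [symmetric] Suc transfer.simps)
qed simp

text \<open>The transfer matrix commutes with the discrete Laplacian on \<open>{lo..hi}\<close> whose boundary condition
  multiplies by \<open>q\<close> when leaving the interval, because its entries \<open>q ^ \<bar>y - x\<bar>\<close> satisfy that
  boundary condition and depend on \<open>y - x\<close> only.\<close>

lemma kernel_commutes:
  fixes g :: "int \<Rightarrow> 'a::comm_ring_1"
  assumes x: "lo \<le> x" "x \<le> hi"
    and g: "g (lo - 1) = q * g lo" "g (hi + 1) = q * g hi"
  shows "(\<Sum>y\<in>{lo..hi}. q ^ nat \<bar>y - x\<bar> * (g (y - 1) + g (y + 1))) =
    (\<Sum>y\<in>{lo..hi}. q ^ nat \<bar>y - (x - 1)\<bar> * g y) + (\<Sum>y\<in>{lo..hi}. q ^ nat \<bar>y - (x + 1)\<bar> * g y)"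
proof -
  define a where "a y = q ^ nat \<bar>y - x\<bar>" for y
  have le: "lo \<le> hi" using x by simp
  have a: "a (lo - 1) = q * a lo" "a (hi + 1) = q * a hi"
  proof -
    have "nat \<bar>lo - 1 - x\<bar> = Suc (nat \<bar>lo - x\<bar>)" "nat \<bar>hi + 1 - x\<bar> = Suc (nat \<bar>hi - x\<bar>)"
      using x by auto
    then show "a (lo - 1) = q * a lo" "a (hi + 1) = q * a hi" by (simp_all only: a_def power_Suc)
  qed
  \<comment> \<open>Summation by parts: each index shift leaves one term at either end, and over
    both shifts these cancel by the boundary conditions for \<open>a\<close> and
    \<open>g\<close>.\<close>
  have "(\<Sum>y\<in>{lo..hi}. a y * g (y - 1)) = (\<Sum>y\<in>{lo-1..hi-1}. a (y + 1) * g y)"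
    by (rule sum.reindex_bij_witness[of _ "\<lambda>y. y + 1" "\<lambda>y. y - 1"]) auto
  also have "\<dots> = (\<Sum>y\<in>{lo..hi}. a (y + 1) * g y) + a lo * g (lo - 1) - a (hi + 1) * g hi"
  proof -
    have "{lo-1..hi} = insert (lo - 1) {lo..hi}" "{lo-1..hi} = insert hi {lo-1..hi-1}"
      using le by auto
    then have "sum (\<lambda>y. a (y + 1) * g y) (insert hi {lo-1..hi-1}) =
        sum (\<lambda>y. a (y + 1) * g y) (insert (lo - 1) {lo..hi})" by simp
    then show ?thesis by (simp add: algebra_simps)
  qed
  finally have left: "(\<Sum>y\<in>{lo..hi}. a y * g (y - 1)) =
      (\<Sum>y\<in>{lo..hi}. a (y + 1) * g y) + a lo * g (lo - 1) - a (hi + 1) * g hi" .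
  have "(\<Sum>y\<in>{lo..hi}. a y * g (y + 1)) = (\<Sum>y\<in>{lo+1..hi+1}. a (y - 1) * g y)"
    by (rule sum.reindex_bij_witness[of _ "\<lambda>y. y - 1" "\<lambda>y. y + 1"]) auto
  also have "\<dots> = (\<Sum>y\<in>{lo..hi}. a (y - 1) * g y) + a hi * g (hi + 1) - a (lo - 1) * g lo"
  proof -
    have "{lo..hi+1} = insert (hi + 1) {lo..hi}" "{lo..hi+1} = insert lo {lo+1..hi+1}"
      using le by auto
    then have "sum (\<lambda>y. a (y - 1) * g y) (insert lo {lo+1..hi+1}) =
        sum (\<lambda>y. a (y - 1) * g y) (insert (hi + 1) {lo..hi})" by simp
    then show ?thesis by (simp add: algebra_simps)
  qed
  finally have "(\<Sum>y\<in>{lo..hi}. a y * (g (y - 1) + g (y + 1))) =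
      (\<Sum>y\<in>{lo..hi}. a (y + 1) * g y) + (\<Sum>y\<in>{lo..hi}. a (y - 1) * g y)"
    unfolding distrib_left sum.distrib left a g by (simp add: mult.left_commute mult.commute)
  then show ?thesis by (simp add: a_def algebra_simps)
qed

text \<open>The distance of \<open>y\<close> from the plateau \<open>{-i..i+1}\<close>; for \<open>i = -1\<close> it is one more than the distance from \<open>{0, 1}\<close>.\<close>

definition plateau_dist :: "int \<Rightarrow> int \<Rightarrow> nat" where
  "plateau_dist i y = nat (if y \<le> 0 then - i - y else y - 1 - i)"

lemma plateau_laplace:
  fixes q :: "'a::comm_ring_1"
  assumes "0 \<le> i"
  shows "q ^ plateau_dist (i - 1) y + q ^ plateau_dist (i + 1) y =
    q ^ plateau_dist i (y - 1) + q ^ plateau_dist i (y + 1)"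
proof -
  have "y \<le> 0 \<Longrightarrow> plateau_dist (i - 1) y = plateau_dist i (y - 1)"
    "y \<le> 0 \<Longrightarrow> plateau_dist (i + 1) y = plateau_dist i (y + 1)"
    "\<not> y \<le> 0 \<Longrightarrow> plateau_dist (i - 1) y = plateau_dist i (y + 1)"
    "\<not> y \<le> 0 \<Longrightarrow> plateau_dist (i + 1) y = plateau_dist i (y - 1)"
    using assms by (auto simp: plateau_dist_def)
  then show ?thesis by (cases "y \<le> 0") (simp_all add: add.commute)
qed

locale strip =
  fixes q :: "'a::{idom,ring_char_0}" and lo hi c :: int
  assumes lo: "lo = - c" and hi: "hi = c \<or> hi = c + 1" and c: "0 \<le> c"
begin

definition wt :: "nat \<Rightarrow> int \<Rightarrow> int \<Rightarrow> 'a" where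
  "wt s i x = transfer q lo hi s (\<lambda>y. q ^ plateau_dist i y) x"

lemma wt_0: "wt 0 i x = q ^ plateau_dist i x"
  by (simp add: wt_def)

lemma wt_Suc: "wt (Suc s) i x = (\<Sum>y\<in>{lo..hi}. q ^ nat \<bar>y - x\<bar> * wt s i y)"
  by (simp add: wt_def)

text \<open>The boundary condition at \<open>i = 0\<close>: shrinking the plateau
  \<open>{0, 1}\<close> once more adds 1 to every distance.\<close>

lemma wt_minus_1: "wt s (- 1) x = q * wt s 0 x"
proof (induction s arbitrary: x)
  case 0
  have "plateau_dist (- 1) x = Suc (plateau_dist 0 x)" by (auto simp add: plateau_dist_def)
  then show ?case by (simp add: wt_0)
next
  case (Suc s)
  then show ?case by (simp add: wt_Suc sum_distrib_left mult.left_commute)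
qed

text \<open>From one step outside the strip, every height in it is one further away than from the
  adjacent edge. For \<open>s = 0\<close> the same holds for the distance to the plateau, which lies
  inside the strip because \<open>i < c\<close>.\<close>

lemma wt_boundary:
  assumes "0 \<le> i" "i < c"
  shows "wt s i (lo - 1) = q * wt s i lo" "wt s i (hi + 1) = q * wt s i hi"
proof -
  have d: "plateau_dist i (lo - 1) = Suc (plateau_dist i lo)"
    "plateau_dist i (hi + 1) = Suc (plateau_dist i hi)"
    using assms lo hi c by (auto simp: plateau_dist_def)
  have "(\<Sum>y\<in>{lo..hi}. q ^ nat \<bar>y - (lo - 1)\<bar> * f y) = (\<Sum>y\<in>{lo..hi}. q ^ Suc (nat \<bar>y - lo\<bar>) * f y)"
    "(\<Sum>y\<in>{lo..hi}. q ^ nat \<bar>y - (hi + 1)\<bar> * f y) = (\<Sum>y\<in>{lo..hi}. q ^ Suc (nat \<bar>y - hi\<bar>) * f y)"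
    for f
    by (intro sum.cong refl arg_cong2[where f = times] arg_cong[where f = "power q"]; auto)+
  then show "wt s i (lo - 1) = q * wt s i lo" "wt s i (hi + 1) = q * wt s i hi"
    by (cases s; simp add: wt_0 d wt_Suc sum_distrib_left mult.assoc)+
qed

lemma wt_laplace:
  assumes "0 \<le> i" "i < c" "lo \<le> x" "x \<le> hi"
  shows "wt s (i - 1) x + wt s (i + 1) x = wt s i (x - 1) + wt s i (x + 1)"
  using assms(3,4)
proof (induction s arbitrary: x)
  case 0
  then show ?case using plateau_laplace[OF assms(1)] by (simp add: wt_0)
next
  case (Suc s)
  have "wt (Suc s) (i - 1) x + wt (Suc s) (i + 1) x =
      (\<Sum>y\<in>{lo..hi}. q ^ nat \<bar>y - x\<bar> * (wt s (i - 1) y + wt s (i + 1) y))"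
    by (simp add: wt_Suc distrib_left sum.distrib)
  also have "\<dots> = (\<Sum>y\<in>{lo..hi}. q ^ nat \<bar>y - x\<bar> * (wt s i (y - 1) + wt s i (y + 1)))"
    by (intro sum.cong) (simp_all add: Suc.IH)
  also have "\<dots> = wt (Suc s) i (x - 1) + wt (Suc s) i (x + 1)"
    using kernel_commutes[OF Suc.prems, of "wt s i", OF wt_boundary[OF assms(1,2)]] by (simp add: wt_Suc)
  finally show ?case .
qed

text \<open>In the variables \<open>i\<close> and \<open>j\<close>, the function \<open>wt s i (lo + j)\<close> satisfies a discrete wave equation
  with the same boundary conditions at \<open>i = 0\<close> and \<open>j = 0\<close>, which forces it to be symmetric.\<close>

lemma wt_symmetric:
  assumes "0 \<le> i" "0 \<le> j" "i + j \<le> c"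
  shows "wt s i (lo + j) = wt s j (lo + i)"
  using assms
proof (induction "nat (i + j)" arbitrary: i j rule: less_induct)
  case less
  define N where "N i j = wt s i (lo + j)" for i j
  define n where "n = i + j - 1"
  show ?case
  proof (cases "n = - 1")
    case True
    then have "i = 0 \<and> j = 0" using less.prems by (simp add: n_def)
    then show ?thesis by simp
  next
    case False
    then have n: "0 \<le> n" "n < c" using less.prems by (auto simp: n_def)
    have sym: "N a b = N b a" if "0 \<le> a" "0 \<le> b" "a + b \<le> n" for a b
      using less.hyps[of a b] that less.prems by (simp add: N_def n_def)
    have bd: "N (- 1) b = q * N 0 b" "0 \<le> a \<Longrightarrow> a < c \<Longrightarrow> N a (- 1) = q * N a 0" for a b
      using wt_minus_1 wt_boundary(1) by (simp_all add: N_def)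
    \<comment> \<open>For \<open>b = 0\<close> the two boundary conditions reduce the claim to
      \<open>N a 0 = N 0 a\<close>.\<close>
    have sym': "N a (b - 1) = N (b - 1) a" if "0 \<le> a" "0 \<le> b" "a + b \<le> n" for a b
    proof (cases "b = 0")
      case True
      then show ?thesis using bd(1)[of a] bd(2)[of a] sym[of a 0] that n by simp
    next
      case False
      then show ?thesis using sym[of a "b - 1"] that by simp
    qed
    have rec: "N (a + 1) b = N a (b - 1) + N a (b + 1) - N (a - 1) b"
      if "0 \<le> a" "0 \<le> b" "a + b \<le> n" for a b
    proof -
      have "lo \<le> lo + b" "lo + b \<le> hi" using that n lo hi by auto
      then show ?thesis
        using wt_laplace[of a "lo + b" s] that n by (simp add: N_def algebra_simps)
    qed
    define E where "E a b = N a b - N b a" for a b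
    \<comment> \<open>A step along the antidiagonal of sum \<open>n + 1\<close> changes
      \<open>N\<close> only by values on that of sum \<open>n - 1\<close>, which are symmetric; so
      the antisymmetric part \<open>E\<close> does not change.\<close>
    have step: "E (a + 1) b = E a (b + 1)" if "0 \<le> a" "0 \<le> b" "a + b = n" for a b
      using rec[of a b] rec[of b a] sym'[of a b] sym'[of b a] that
      by (simp add: E_def add.commute)
    have const: "E (int a) (n + 1 - int a) = E 0 (n + 1)" if "int a \<le> n + 1" for a
      using that
    proof (induction a)
      case (Suc a)
      then show ?case using step[of "int a" "n - int a"] by (simp add: algebra_simps)
    qed simp
    \<comment> \<open>Swapping the arguments negates \<open>E\<close>, so in characteristic 0 the
      constant vanishes.\<close>
    have "E (n + 1) 0 = E 0 (n + 1)" using const[of "nat (n + 1)"] n by simp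
    then have "E 0 (n + 1) = - E 0 (n + 1)" by (simp add: E_def)
    then have "2 * E 0 (n + 1) = 0" by (simp add: eq_neg_iff_add_eq_0 flip: mult_2)
    then have "E 0 (n + 1) = 0" by simp
    then have "E i j = 0" using const[of "nat i"] less.prems by (simp add: n_def)
    then show ?thesis by (simp add: E_def N_def)
  qed
qed

text \<open>The case \<open>i = c\<close>, \<open>j = 0\<close> of \<open>wt_symmetric\<close>: the
  plateau for \<open>c\<close> covers the strip, so its weights are 1, and
  \<open>lo + c = 0\<close>.\<close>

lemma sum_prefix_cost_eq:
  "(\<Sum>hs\<in>lists_between lo hi s. q ^ nat (prefix_cost lo hs)) =
   (\<Sum>hs\<in>lists_between lo hi s. q ^ (nat (prefix_cost 0 hs) + plateau_dist 0 (last (0 # hs))))"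
proof -
  have one: "plateau_dist c (last (lo # hs)) = 0" if "hs \<in> lists_between lo hi s" for hs
  proof -
    have "last (lo # hs) \<in> {lo..hi}"
      using that last_in_set[of hs] lo hi c by (auto simp: lists_between_def simp del: last_in_set)
    then show ?thesis using lo hi by (auto simp: plateau_dist_def)
  qed
  have "(\<Sum>hs\<in>lists_between lo hi s. q ^ nat (prefix_cost lo hs)) = wt s c lo"
    unfolding wt_def sum_prefix_cost[symmetric] by (intro sum.cong) (simp_all add: one del: last.simps)
  also have "\<dots> = wt s 0 0"
    using wt_symmetric[of c 0] c lo by simp
  finally show ?thesis
    unfolding wt_def sum_prefix_cost[symmetric] by (simp add: power_add)
qed

end

text \<open>Read backwards, the first entry becomes the last height. The final move to 0, less the
  correction for a positive entry, is its distance from \<open>{0, 1}\<close>.\<close>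

lemma cost_rev: "cost (rev hs) = int (nat (prefix_cost 0 hs) + plateau_dist 0 (last (0 # hs)))"
proof -
  have "hd (rev hs @ [0]) = last (0 # hs)" by (cases hs rule: rev_cases) auto
  then show ?thesis
    using prefix_cost_nonneg[of 0 hs] tv_rev[of 0 hs 0] tv_eq_prefix_cost[of 0 hs 0]
    by (auto simp: cost_def plateau_dist_def simp del: last.simps)
qed

text \<open>\<open>[:0, 1:]\<close> is the polynomial variable, so the coefficient at
  \<open>m\<close> counts the elements of value \<open>m\<close>.\<close>

lemma card_eq_if_sum_monom_eq:
  fixes f g :: "_ \<Rightarrow> nat"
  assumes "finite A" "(\<Sum>x\<in>A. [:0, 1 :: int:] ^ f x) = (\<Sum>x\<in>A. [:0, 1:] ^ g x)"
  shows "card {x \<in> A. f x = m} = card {x \<in> A. g x = m}"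
proof -
  have pow: "[:0, 1 :: int:] ^ n = monom 1 n" for n
    by (simp add: monom_altdef)
  have "coeff (\<Sum>x\<in>A. [:0, 1 :: int:] ^ h x) m = int (card {x \<in> A. h x = m})" for h :: "_ \<Rightarrow> nat"
  proof -
    have "coeff (\<Sum>x\<in>A. [:0, 1 :: int:] ^ h x) m = (\<Sum>x\<in>A. if h x = m then 1 else 0)"
      by (simp add: coeff_sum pow)
    then show ?thesis using assms(1) by (simp add: sum.If_cases Int_def)
  qed
  then show ?thesis using assms(2) by (metis of_nat_eq_iff)
qed

lemma core_sequences_eqpoll_Pre_c: "core_sequences s m k \<approx> Pre_c m s k"
proof -
  define lo hi where "lo = - int (k div 2)" and "hi = int ((k + 1) div 2)"
  let ?L = "lists_between lo hi s"
  interpret strip "[:0, 1 :: int:]" lo hi "int (k div 2)"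
    by standard (auto simp: lo_def hi_def)
  have k: "int k = hi - lo" unfolding lo_def hi_def by linarith
  have "bij_betw rev {hs \<in> ?L. cost (rev hs) = int m} (core_sequences s m k)"
    by (rule bij_betw_byWitness[where f' = rev])
       (auto simp: core_sequences_eq lists_between_def lo_def hi_def)
  then have "bij_betw rev {hs \<in> ?L. nat (prefix_cost 0 hs) + plateau_dist 0 (last (0 # hs)) = m}
      (core_sequences s m k)"
    by (simp only: cost_rev of_nat_eq_iff)
  then have "{hs \<in> ?L. nat (prefix_cost 0 hs) + plateau_dist 0 (last (0 # hs)) = m} \<approx>
      core_sequences s m k"
    unfolding eqpoll_def by (rule exI[of _ rev])
  then have "core_sequences s m k \<approx>
      {hs \<in> ?L. nat (prefix_cost 0 hs) + plateau_dist 0 (last (0 # hs)) = m}"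
    by (rule eqpoll_sym)
  also have "\<dots> \<approx> {hs \<in> ?L. nat (prefix_cost lo hs) = m}"
    using card_eq_if_sum_monom_eq[OF _ sum_prefix_cost_eq, of s m]
    by (simp add: eqpoll_iff_card)
  also have "\<dots> \<approx> {hs \<in> lists_between 0 (int k) s. prefix_cost 0 hs = int m}"
  proof -
    have tr: "prefix_cost (a + d) (map (\<lambda>x. x + d) hs) = prefix_cost a hs" for a d hs
      by (induction hs arbitrary: a) auto
    have "bij_betw (map (\<lambda>x. x + (- lo))) {hs \<in> ?L. nat (prefix_cost lo hs) = m}
        {hs \<in> lists_between 0 (int k) s. prefix_cost 0 hs = int m}"
    proof (rule bij_betw_byWitness[where f' = "map (\<lambda>x. x + lo)"])
      show "map (\<lambda>x. x + - lo) ` {hs \<in> ?L. nat (prefix_cost lo hs) = m}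
          \<subseteq> {hs \<in> lists_between 0 (int k) s. prefix_cost 0 hs = int m}"
        using tr[of lo "- lo"] prefix_cost_nonneg
        by (auto simp: lists_between_def k subset_eq simp del: add_uminus_conv_diff)
      show "map (\<lambda>x. x + lo) ` {hs \<in> lists_between 0 (int k) s. prefix_cost 0 hs = int m}
          \<subseteq> {hs \<in> ?L. nat (prefix_cost lo hs) = m}"
        using tr[of 0 lo] by (auto simp: lists_between_def k subset_eq)
    qed (auto simp: map_idI)
    then show ?thesis by (auto simp: eqpoll_def)
  qed
  also have "\<dots> \<approx> Pre_c m s k" by (rule prefix_lists_eqpoll_Pre_c)
  finally show ?thesis .
qed

section \<open>Partitions and their bead sets\<close>

definition row :: "nat list \<Rightarrow> nat \<Rightarrow> nat" where
  "row l i = (if i < length l then l ! i else 0)"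

definition col :: "nat list \<Rightarrow> nat \<Rightarrow> nat" where
  "col l j = card {i. j < row l i}"

text \<open>Rows are counted from 0, hence the extra \<open>- 1\<close>. For
  \<open>f = row l\<close> the zero rows below the diagram supply all sufficiently negative
  beads.\<close>

definition bead :: "(nat \<Rightarrow> nat) \<Rightarrow> nat \<Rightarrow> int" where
  "bead f i = int (f i) - int i - 1"

lemma down_closed_iff_less_card:
  fixes A :: "nat set"
  assumes "finite A" "\<And>i j. i \<in> A \<Longrightarrow> j \<le> i \<Longrightarrow> j \<in> A"
  shows "i \<in> A \<longleftrightarrow> i < card A"
proof (cases "A = {}")
  case False
  then have "A = {..Max A}"
    using assms Max_in[of A] Max_ge[of A] by blast
  then show ?thesis by (metis atMost_iff card_atMost less_Suc_eq_le)
qed simp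

lemma row_antimono:
  assumes "is_partition l" "i \<le> i'"
  shows "row l i' \<le> row l i"
  using assms by (cases "i = i'") (auto simp: is_partition_def row_def sorted_wrt_iff_nth_less)

lemma row_pos_iff: "is_partition l \<Longrightarrow> 0 < row l i \<longleftrightarrow> i < length l"
  by (auto simp: is_partition_def row_def)

lemma row_inject:
  assumes "is_partition l" "is_partition l'" "row l = row l'"
  shows "l = l'"
proof (rule nth_equalityI)
  have iff: "i < length l \<longleftrightarrow> i < length l'" for i
    using row_pos_iff assms by metis
  show len: "length l = length l'"
    using iff[of "length l"] iff[of "length l'"] by simp
  show "l ! i = l' ! i" if "i < length l" for i
    using fun_cong[OF assms(3), of i] that len by (simp add: row_def)
qed

lemma less_row_iff_less_col:
  assumes "is_partition l"
  shows "j < row l i \<longleftrightarrow> i < col l j"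
proof -
  have "finite {i. j < row l i}"
    by (rule finite_subset[of _ "{..<length l}"]) (auto simp: row_def split: if_splits)
  moreover have "i' \<in> {i. j < row l i}" if "i \<in> {i. j < row l i}" "i' \<le> i" for i i'
    using row_antimono[OF assms that(2)] that(1) by simp
  ultimately show ?thesis
    using down_closed_iff_less_card[of "{i. j < row l i}" i] by (simp add: col_def)
qed

lemma young_diagram_Suc [simp]: "(Suc i, Suc j) \<in> young_diagram l \<longleftrightarrow> j < row l i"
  by (auto simp: young_diagram_def row_def)

lemma young_diagram_pos: "(i, j) \<in> young_diagram l \<Longrightarrow> 0 < i \<and> 0 < j"
  by (auto simp: young_diagram_def)

lemma hook_length_eq:
  assumes "is_partition l"
  shows "hook_length l (Suc i) (Suc j) = (row l i - Suc j) + (col l j - Suc i) + 1"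
proof -
  have "{j'. Suc j < j' \<and> (Suc i, j') \<in> young_diagram l} = {Suc (Suc j)..row l i}"
    by (auto simp: young_diagram_def row_def split: if_splits)
  moreover have "{i'. Suc i < i' \<and> (i', Suc j) \<in> young_diagram l} = {Suc (Suc i)..col l j}"
  proof (intro set_eqI)
    fix i'
    show "i' \<in> {i'. Suc i < i' \<and> (i', Suc j) \<in> young_diagram l} \<longleftrightarrow> i' \<in> {Suc (Suc i)..col l j}"
      by (cases i') (auto simp: less_row_iff_less_col[OF assms])
  qed
  ultimately show ?thesis by (simp add: hook_length_def)
qed

lemma ex_partition_row:
  assumes anti: "\<And>i i'. i \<le> i' \<Longrightarrow> f i' \<le> f i" and fin: "f n = 0"
  shows "\<exists>l. is_partition l \<and> row l = f"
proof -
  define k where "k = (LEAST n. f n = 0)"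
  have k: "f i = 0 \<longleftrightarrow> k \<le> i" for i
    using LeastI[of "\<lambda>n. f n = 0", OF fin] Least_le[of "\<lambda>n. f n = 0" i] anti[of k i]
    by (auto simp: k_def)
  have "is_partition (map f [0..<k])"
    using anti k by (auto simp: is_partition_def sorted_wrt_iff_nth_less) (metis gr0I not_le)
  moreover have "row (map f [0..<k]) = f"
    using k by (auto simp: row_def fun_eq_iff)
  ultimately show ?thesis by blast
qed

section \<open>Uniqueness and complement of a bead set\<close>

lemma bead_strict_antimono:
  assumes "\<And>i i'. i \<le> i' \<Longrightarrow> f i' \<le> f i" "i < i'"
  shows "bead f i' < bead f i"
  using assms(1)[of i i'] assms(2) by (simp add: bead_def)

lemma bead_range_inject:
  assumes f: "\<And>i i'. i \<le> i' \<Longrightarrow> f i' \<le> f i" and g: "\<And>i i'. i \<le> i' \<Longrightarrow> g i' \<le> g i"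
    and eq: "range (bead f) = range (bead g)"
  shows "f = g"
proof
  fix n
  have le: "bead f n \<le> bead g n"
    if f: "\<And>i i'. i \<le> i' \<Longrightarrow> f i' \<le> f i" and g: "\<And>i i'. i \<le> i' \<Longrightarrow> g i' \<le> g i"
      and eq: "range (bead f) = range (bead g)" and IH: "\<And>m. m < n \<Longrightarrow> f m = g m" for f g n
  proof -
    obtain m where m: "bead f n = bead g m" using eq by (metis rangeE rangeI)
    have "\<not> m < n"
      using IH[of m] m bead_strict_antimono[of f m n, OF f] by (auto simp: bead_def)
    then show ?thesis
      using m bead_strict_antimono[of g n m, OF g] by (cases "n = m") auto
  qed
  show "f n = g n"
  proof (induction n rule: less_induct)
    case (less n)
    then have "bead f n = bead g n"
      using le[OF f g eq, of n] le[OF g f eq[symmetric], of n] by fastforce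
    then show ?case by (simp add: bead_def)
  qed
qed

text \<open>The hypothesis says that \<open>f\<close> and \<open>g\<close> are the row and column lengths of the same diagram.\<close>

lemma bead_sum:
  assumes "\<And>i j. j < f i \<longleftrightarrow> i < g j"
  shows "j < f i \<Longrightarrow> 0 \<le> bead f i + bead g j" "\<not> j < f i \<Longrightarrow> bead f i + bead g j \<le> - 2"
  using assms[of j i] by (auto simp: bead_def)

text \<open>The sum \<open>bead f i + bead g j\<close> is never \<open>- 1\<close>, so no bead is
  the mirror image of a column bead. Conversely, for a position \<open>x\<close> missed by the rows,
  let \<open>i\<close> be the first row with bead below \<open>x\<close>; then column
  \<open>x + i\<close> has length exactly \<open>i\<close>.\<close>

lemma bead_complement:
  assumes c: "\<And>i j. j < f i \<longleftrightarrow> i < g j"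
  shows "x \<notin> range (bead f) \<longleftrightarrow> - 1 - x \<in> range (bead g)"
proof
  assume "- 1 - x \<in> range (bead g)"
  then obtain j where j: "bead g j = - 1 - x" by auto
  have "bead f i + bead g j \<noteq> - 1" for i
    using bead_sum[OF c, of j i] by fastforce
  then show "x \<notin> range (bead f)" using j by auto
next
  assume x: "x \<notin> range (bead f)"
  have ex: "\<exists>i. bead f i \<le> x"
  proof -
    have "f (max (g 0) (nat (- x))) = 0" using c[of 0 "max (g 0) (nat (- x))"] by auto
    then have "bead f (max (g 0) (nat (- x))) \<le> x" by (simp add: bead_def)
    then show ?thesis by blast
  qed
  define i where "i = (LEAST i. bead f i \<le> x)"
  have "bead f i \<le> x" using LeastI_ex[OF ex] by (simp add: i_def)
  moreover have "bead f i \<noteq> x" using x by auto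
  ultimately have less: "bead f i < x" by simp
  define j where "j = nat (x + int i)"
  have j: "int j = x + int i" using less by (simp add: j_def bead_def)
  have "\<not> i < g j" using less j c[of j i] by (simp add: bead_def)
  moreover have "i \<le> g j"
  proof (cases i)
    case (Suc i')
    then have "\<not> bead f i' \<le> x" using not_less_Least[of i' "\<lambda>i. bead f i \<le> x"] by (simp add: i_def)
    then show ?thesis using c[of j i'] j Suc by (simp add: bead_def)
  qed simp
  ultimately have "bead g j = - 1 - x" using j by (simp add: bead_def)
  then show "- 1 - x \<in> range (bead g)" by (metis rangeI)
qed

definition beads :: "nat list \<Rightarrow> int set" where
  "beads l = range (bead (row l))"

lemma not_in_beads_iff: "is_partition l \<Longrightarrow> x \<notin> beads l \<longleftrightarrow> - 1 - x \<in> range (bead (col l))"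
  unfolding beads_def by (rule bead_complement) (rule less_row_iff_less_col)

lemma beads_inject: "is_partition l \<Longrightarrow> is_partition l' \<Longrightarrow> beads l = beads l' \<Longrightarrow> l = l'"
  unfolding beads_def by (intro row_inject bead_range_inject row_antimono)

section \<open>Self-conjugacy, cores, corners and the first hook read off the beads\<close>

lemma self_conjugate_iff_col:
  assumes "is_partition l"
  shows "self_conjugate l \<longleftrightarrow> col l = row l"
proof -
  have len: "length (conjugate l) = row l 0"
    by (simp add: conjugate_def row_def hd_conv_nth)
  have nth: "conjugate l ! j = col l j" if "j < row l 0" for j
  proof -
    have "{i. (i, Suc j) \<in> young_diagram l} = Suc ` {i. j < row l i}"
    proof (intro set_eqI)
      fix i
      show "i \<in> {i. (i, Suc j) \<in> young_diagram l} \<longleftrightarrow> i \<in> Suc ` {i. j < row l i}"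
        using young_diagram_pos[of 0 "Suc j" l] by (cases i) auto
    qed
    moreover have "j < length [1..<Suc (if l = [] then 0 else hd l)]"
      using that by (simp add: row_def hd_conv_nth split: if_splits)
    ultimately show ?thesis by (simp add: conjugate_def col_def card_image del: upt_Suc)
  qed
  have col0: "col l j = 0" if "row l 0 \<le> j" for j
    using less_row_iff_less_col[OF assms, of j 0] that by simp
  have row_conj: "row (conjugate l) = col l"
    by (auto simp: fun_eq_iff row_def[of "conjugate l"] len nth col0)
  show ?thesis
  proof
    assume "col l = row l"
    have "row l 0 = length l"
    proof -
      have "i < row l 0 \<longleftrightarrow> i < length l" for i
        using less_row_iff_less_col[OF assms, of 0 i] row_pos_iff[OF assms, of i] \<open>col l = row l\<close>
        by simp
      then show ?thesis by (metis less_irrefl linorder_neqE_nat)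
    qed
    then have "conjugate l = l"
      using len nth \<open>col l = row l\<close> by (intro nth_equalityI) (auto simp: row_def)
    then show "self_conjugate l" by (simp add: self_conjugate_def)
  qed (use row_conj in \<open>simp add: self_conjugate_def\<close>)
qed

lemma self_conjugate_iff_beads:
  assumes "is_partition l"
  shows "self_conjugate l \<longleftrightarrow> (\<forall>x. x \<in> beads l \<longleftrightarrow> - 1 - x \<notin> beads l)"
proof
  assume "self_conjugate l"
  then show "\<forall>x. x \<in> beads l \<longleftrightarrow> - 1 - x \<notin> beads l"
    using not_in_beads_iff[OF assms] self_conjugate_iff_col[OF assms] unfolding beads_def by metis
next
  assume sd: "\<forall>x. x \<in> beads l \<longleftrightarrow> - 1 - x \<notin> beads l"
  have "x \<in> range (bead (col l)) \<longleftrightarrow> x \<in> beads l" for x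
    using not_in_beads_iff[OF assms, of "- 1 - x"] sd[rule_format, of x] by simp
  then have "range (bead (col l)) = range (bead (row l))"
    by (auto simp: beads_def)
  moreover have "col l j' \<le> col l j" if "j \<le> j'" for j j'
    using less_row_iff_less_col[OF assms] that by (meson le_less_trans not_le order_refl)
  ultimately have "col l = row l"
    using row_antimono[OF assms] by (intro bead_range_inject) auto
  then show "self_conjugate l" using self_conjugate_iff_col[OF assms] by simp
qed

text \<open>By \<open>bead_complement\<close>, the hook lengths in a row are the differences between
  its bead and the smaller non-beads. A hook of length \<open>t\<close> is therefore a bead
  \<open>x\<close> with \<open>x - t\<close> no bead.\<close>

lemma t_core_iff_beads:
  assumes l: "is_partition l" and "0 < t"
  shows "t_core t l \<longleftrightarrow> (\<forall>x\<in>beads l. x - int t \<in> beads l)"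
proof -
  have c: "j < row l i \<longleftrightarrow> i < col l j" for i j using less_row_iff_less_col[OF l] .
  have hook: "int (hook_length l (Suc i) (Suc j)) = bead (row l) i + bead (col l) j + 1"
    if "j < row l i" for i j
  proof -
    have "i < col l j" using that c by blast
    then show ?thesis using that unfolding hook_length_eq[OF l] bead_def by linarith
  qed
  have "t_core t l \<longleftrightarrow> (\<forall>i j. j < row l i \<longrightarrow> hook_length l (Suc i) (Suc j) \<noteq> t)"
  proof
    assume *: "\<forall>i j. j < row l i \<longrightarrow> hook_length l (Suc i) (Suc j) \<noteq> t"
    have "hook_length l i j \<noteq> t" if ij: "(i, j) \<in> young_diagram l" for i j
    proof -
      obtain i' j' where "i = Suc i'" "j = Suc j'"
        using young_diagram_pos[OF ij] by (auto simp: gr0_conv_Suc)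
      then show ?thesis using * ij by simp
    qed
    then show "t_core t l" by (auto simp: t_core_def)
  qed (auto simp: t_core_def)
  also have "\<dots> \<longleftrightarrow> (\<forall>i j. bead (row l) i + bead (col l) j + 1 \<noteq> int t)"
  proof -
    have "j < row l i" if "bead (row l) i + bead (col l) j + 1 = int t" for i j
      using bead_sum(2)[of "row l" "col l", OF c, of j i] that by linarith
    then have "(j < row l i \<longrightarrow> hook_length l (Suc i) (Suc j) \<noteq> t) \<longleftrightarrow>
        bead (row l) i + bead (col l) j + 1 \<noteq> int t" for i j
      using hook[of j i] by (metis of_nat_eq_iff)
    then show ?thesis by simp
  qed
  also have "\<dots> \<longleftrightarrow> (\<forall>i. - 1 - (bead (row l) i - int t) \<notin> range (bead (col l)))"
  proof -
    have "bead (row l) i + bead (col l) j + 1 = int t \<longleftrightarrow>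
        - 1 - (bead (row l) i - int t) = bead (col l) j" for i j
      by linarith
    then show ?thesis by (simp add: image_iff)
  qed
  also have "\<dots> \<longleftrightarrow> (\<forall>x\<in>beads l. x - int t \<in> beads l)"
    by (simp add: not_in_beads_iff[OF l, symmetric]) (simp add: beads_def)
  finally show ?thesis .
qed

lemma inner_corners_eq:
  assumes l: "is_partition l"
  shows "inner_corners l = (\<lambda>i. (Suc i, row l i)) ` {i. row l (Suc i) < row l i}"
proof (intro equalityI subsetI)
  fix c assume "c \<in> inner_corners l"
  then obtain l' where c: "c \<in> young_diagram l" and l': "is_partition l'"
    "young_diagram l' = young_diagram l - {c}"
    unfolding inner_corners_def by auto
  obtain i j where ij: "c = (Suc i, Suc j)"
    using c young_diagram_pos by (cases c) (metis gr0_conv_Suc)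
  have iff: "j' < row l' i' \<longleftrightarrow> j' < row l i' \<and> (i', j') \<noteq> (i, j)" for i' j'
    using l'(2) ij young_diagram_Suc[of i' j' l'] young_diagram_Suc[of i' j' l] by auto
  have "j < row l i" using c ij by simp
  moreover have "\<not> Suc j < row l i" using iff[of "Suc j" i] iff[of j i] by auto
  moreover have "\<not> j < row l (Suc i)"
    using iff[of j "Suc i"] iff[of j i] row_antimono[OF l'(1), of i "Suc i"] by auto
  ultimately show "c \<in> (\<lambda>i. (Suc i, row l i)) ` {i. row l (Suc i) < row l i}"
    using ij by auto
next
  fix c assume "c \<in> (\<lambda>i. (Suc i, row l i)) ` {i. row l (Suc i) < row l i}"
  then obtain i j where c: "c = (Suc i, Suc j)" and j: "row l i = Suc j" and i: "row l (Suc i) \<le> j"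
    by (auto simp: gr0_conv_Suc dest: less_imp_Suc_add)
  \<comment> \<open>The rows after removing the last box of row \<open>i\<close>; they still
    decrease weakly because the next row was strictly shorter.\<close>
  define f where "f = (row l)(i := j)"
  have anti: "f b \<le> f a" if "a \<le> b" for a b
  proof -
    have "row l b \<le> j" if "i < b"
      using row_antimono[OF l, of "Suc i" b] i that by simp
    then show ?thesis
      using that row_antimono[OF l, of a b] j by (auto simp: f_def)
  qed
  have "f (Suc i + length l) = 0" by (simp add: f_def row_def)
  then obtain l' where l': "is_partition l'" "row l' = f" using ex_partition_row[of f] anti by blast
  have "young_diagram l' = young_diagram l - {c}"
  proof (rule set_eqI, clarify)
    fix a b
    show "(a, b) \<in> young_diagram l' \<longleftrightarrow> (a, b) \<in> young_diagram l - {c}"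
    proof (cases "0 < a \<and> 0 < b")
      case True
      then obtain a' b' where "a = Suc a'" "b = Suc b'" by (auto simp: gr0_conv_Suc)
      then show ?thesis using j by (auto simp: l' f_def c)
    qed (use young_diagram_pos in blast)
  qed
  then show "c \<in> inner_corners l"
    unfolding inner_corners_def using l'(1) c j by auto
qed

text \<open>Consecutive beads differ by 1 exactly when the two rows have equal length.\<close>

lemma card_inner_corners:
  assumes l: "is_partition l"
  shows "card (inner_corners l) = card {x \<in> beads l. x - 1 \<notin> beads l}"
proof -
  let ?I = "{i. row l (Suc i) < row l i}"
  have anti: "bead (row l) i' < bead (row l) i \<longleftrightarrow> i < i'" for i i'
    using bead_strict_antimono[of "row l", OF row_antimono[OF l]]
    by (metis less_asym linorder_less_linear order_less_irrefl)
  have iff: "bead (row l) i - 1 \<in> beads l \<longleftrightarrow> \<not> row l (Suc i) < row l i" for i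
  proof
    assume "bead (row l) i - 1 \<in> beads l"
    then obtain i' where i': "bead (row l) i - 1 = bead (row l) i'" by (auto simp: beads_def)
    then have "i < i'" using anti[of i' i] by linarith
    then have "\<not> bead (row l) (Suc i) < bead (row l) i'" using anti[of "Suc i" i'] by simp
    then show "\<not> row l (Suc i) < row l i" using i' by (simp add: bead_def)
  next
    assume "\<not> row l (Suc i) < row l i"
    then have "bead (row l) i - 1 = bead (row l) (Suc i)"
      using row_antimono[OF l, of i "Suc i"] by (simp add: bead_def)
    then show "bead (row l) i - 1 \<in> beads l" by (simp add: beads_def)
  qed
  have "{x \<in> beads l. x - 1 \<notin> beads l} = bead (row l) ` ?I"
    using iff by (auto simp: beads_def)
  moreover have "inj (bead (row l))"
    using anti by (metis injI less_irrefl linorder_neqE_nat)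
  ultimately have "card {x \<in> beads l. x - 1 \<notin> beads l} = card ?I"
    by (simp add: card_image inj_on_subset)
  moreover have "card (inner_corners l) = card ?I"
    unfolding inner_corners_eq[OF l] by (rule card_image) (simp add: inj_on_def)
  ultimately show ?thesis by simp
qed

text \<open>By self-conjugacy the first hook has length \<open>2 * row l 0 - 1\<close>, which is
  \<open>2 * x + 1\<close> for the largest bead \<open>x\<close>. The empty partition has largest
  bead \<open>- 1\<close> and meets every bound, in agreement with the convention.\<close>

lemma first_hook_iff_beads:
  assumes l: "is_partition l" and sc: "self_conjugate l"
  shows "l = [] \<or> hook_length l 1 1 < n \<longleftrightarrow> (\<forall>x\<in>beads l. 2 * x + 1 < int n)"
proof -
  have "(\<forall>x\<in>beads l. 2 * x + 1 < int n) \<longleftrightarrow> 2 * bead (row l) 0 + 1 < int n"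
  proof
    assume *: "2 * bead (row l) 0 + 1 < int n"
    have "bead (row l) i \<le> bead (row l) 0" for i
      using row_antimono[OF l, of 0 i] by (simp add: bead_def)
    then show "\<forall>x\<in>beads l. 2 * x + 1 < int n"
      using * unfolding beads_def by (auto intro: le_less_trans[rotated])
  qed (simp add: beads_def)
  moreover have "hook_length l 1 1 = 2 * row l 0 - 1" if "l \<noteq> []"
    using hook_length_eq[OF l, of 0 0] self_conjugate_iff_col[OF l] sc row_pos_iff[OF l, of 0] that
    by simp
  ultimately show ?thesis
    using row_pos_iff[OF l, of 0] by (cases "l = []") (auto simp: bead_def row_def)
qed

text \<open>Duality pairs beads with non-beads in the window \<open>{- N..<N}\<close>, so exactly
  \<open>N\<close> of its positions are beads. Listed in decreasing order, they give the first
  \<open>N\<close> rows, and the beads below the window give zero rows.\<close>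

lemma ex_partition_beads:
  assumes sd: "\<forall>x. x \<in> S \<longleftrightarrow> - 1 - x \<notin> S" and bd: "\<forall>x\<in>S. x < b"
  shows "\<exists>l. is_partition l \<and> beads l = S"
proof -
  have sd': "- 1 - x \<in> S \<longleftrightarrow> x \<notin> S" for x using sd by blast
  define N where "N = nat b"
  have bd: "x < int N" if "x \<in> S" for x using bd that by (auto simp: N_def)
  have below: "x \<in> S" if "x < - int N" for x using sd[rule_format, of x] bd[of "- 1 - x"] that by auto
  define T where "T = S \<inter> {- int N..<int N}"
  have T: "finite T" by (simp add: T_def)
  have card: "card T = N"
  proof -
    have "bij_betw (\<lambda>x. - 1 - x) T ({- int N..<int N} - T)"
      by (rule bij_betw_byWitness[where f' = "\<lambda>x. - 1 - x"]) (auto simp: T_def sd')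
    then have "card T = card ({- int N..<int N} - T)" by (rule bij_betw_same_card)
    also have "\<dots> = card {- int N..<int N} - card T"
      by (rule card_Diff_subset) (auto simp: T_def)
    finally have "card T = card {- int N..<int N} - card T" .
    moreover have "card T \<le> card {- int N..<int N}" by (rule card_mono) (auto simp: T_def)
    ultimately show ?thesis by simp
  qed
  define L where "L = sorted_list_of_set T"
  have len: "length L = N" and setL: "set L = T" using T card by (simp_all add: L_def)
  \<comment> \<open>Distinct sorted integers are at least as far apart as their indices; this makes
    the rows both non-negative and non-increasing.\<close>
  have gap: "L ! p + (int q - int p) \<le> L ! q" if "p \<le> q" "q < N" for p q
    using that
  proof (induction q rule: dec_induct)
    case (step q)
    have "L ! q < L ! Suc q"
      using strict_sorted_list_of_set[of T] step len
      by (simp add: L_def sorted_wrt_iff_nth_less)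
    then show ?case using step by simp
  qed simp
  define e where "e i = L ! (N - 1 - i)" for i
  have e_low: "0 \<le> e i + int i + 1" if "i < N" for i
  proof -
    have "L ! 0 \<in> T" using setL len that by (metis nth_mem gr_implies_not0 not_gr_zero)
    then have "- int N \<le> L ! 0" by (simp add: T_def)
    then show ?thesis using gap[of 0 "N - 1 - i"] that by (simp add: e_def of_nat_diff)
  qed
  have e_anti: "e i' + int i' \<le> e i + int i" if "i \<le> i'" "i' < N" for i i'
  proof -
    have "N - 1 - i' \<le> N - 1 - i" "N - 1 - i < N" using that by auto
    then show ?thesis using gap[of "N - 1 - i'" "N - 1 - i"] that by (simp add: e_def of_nat_diff)
  qed
  have e_img: "e ` {..<N} = T"
  proof -
    have "e ` {..<N} = (!) L ` {..<N}"
    proof (intro equalityI subsetI)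
      fix x assume "x \<in> (!) L ` {..<N}"
      then obtain i where "i < N" "x = L ! i" by auto
      then have "x = e (N - 1 - i)" "N - 1 - i < N" by (auto simp: e_def)
      then show "x \<in> e ` {..<N}" by blast
    qed (auto simp: e_def)
    then show ?thesis using setL len by (auto simp: set_conv_nth)
  qed
  define f where "f i = (if i < N then nat (e i + int i + 1) else 0)" for i
  have "\<exists>l. is_partition l \<and> row l = f"
    using e_anti by (intro ex_partition_row[of _ N]) (fastforce simp: f_def)+
  moreover have "range (bead f) = S"
  proof -
    have "bead f i = e i" if "i < N" for i using e_low[OF that] that by (simp add: bead_def f_def)
    then have "bead f ` {..<N} = T" using e_img by (metis (mono_tags, lifting) image_cong lessThan_iff)
    moreover have "bead f ` {N..} = {..<- int N}"
    proof (intro equalityI subsetI)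
      fix x assume "x \<in> {..<- int N}"
      then have "x = bead f (nat (- 1 - x))" "nat (- 1 - x) \<in> {N..}" by (auto simp: bead_def f_def)
      then show "x \<in> bead f ` {N..}" by blast
    qed (auto simp: bead_def f_def)
    moreover have "range (bead f) = bead f ` {..<N} \<union> bead f ` {N..}"
    proof -
      have "UNIV = {..<N} \<union> {N..}" by auto
      then show ?thesis by (metis image_Un)
    qed
    moreover have "S = T \<union> {..<- int N}"
    proof (rule set_eqI)
      show "x \<in> S \<longleftrightarrow> x \<in> T \<union> {..<- int N}" for x
        using below[of x] bd[of x] by (auto simp: T_def)
    qed
    ultimately show ?thesis by simp
  qed
  ultimately show ?thesis by (auto simp: beads_def)
qed

definition bead_sets :: "nat \<Rightarrow> nat \<Rightarrow> nat \<Rightarrow> int set set" where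
  "bead_sets t m k =
     {S. (\<forall>x. x \<in> S \<longleftrightarrow> - 1 - x \<notin> S) \<and> (\<forall>x\<in>S. x - int t \<in> S) \<and>
         card {x \<in> S. x - 1 \<notin> S} = m \<and> (\<forall>x\<in>S. 2 * x + 1 < int (k * t))}"

lemma bij_betw_beads:
  assumes "0 < t"
  shows "bij_betw beads (self_conjugate_cores t m k) (bead_sets t m k)"
proof -
  have iff: "l \<in> self_conjugate_cores t m k \<longleftrightarrow> beads l \<in> bead_sets t m k" if "is_partition l" for l
  proof -
    have "l \<in> self_conjugate_cores t m k \<longleftrightarrow> self_conjugate l \<and> t_core t l \<and>
        card (inner_corners l) = m \<and> (l = [] \<or> hook_length l 1 1 < k * t)"
      using that by (simp add: self_conjugate_cores_def)
    also have "\<dots> \<longleftrightarrow> self_conjugate l \<and> (\<forall>x\<in>beads l. x - int t \<in> beads l) \<and>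
        card {x \<in> beads l. x - 1 \<notin> beads l} = m \<and> (\<forall>x\<in>beads l. 2 * x + 1 < int (k * t))"
      using first_hook_iff_beads[OF that]
      unfolding t_core_iff_beads[OF that assms] card_inner_corners[OF that] by blast
    also have "\<dots> \<longleftrightarrow> beads l \<in> bead_sets t m k"
      unfolding self_conjugate_iff_beads[OF that] bead_sets_def mem_Collect_eq by (rule refl)
    finally show ?thesis .
  qed
  have part: "is_partition l" if "l \<in> self_conjugate_cores t m k" for l
    using that by (simp add: self_conjugate_cores_def)
  have ex: "\<exists>l. is_partition l \<and> beads l = S" if "S \<in> bead_sets t m k" for S
  proof (rule ex_partition_beads)
    note S = that[unfolded bead_sets_def mem_Collect_eq]
    show "\<forall>x. x \<in> S \<longleftrightarrow> - 1 - x \<notin> S"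
      using S by (rule conjunct1)
    show "\<forall>x\<in>S. x < int (k * t) + 1"
    proof
      fix x assume "x \<in> S"
      then have "2 * x + 1 < int (k * t)" using S by blast
      then show "x < int (k * t) + 1" using of_nat_0_le_iff[of "k * t"] by linarith
    qed
  qed
  show ?thesis
    unfolding bij_betw_def
  proof
    show "inj_on beads (self_conjugate_cores t m k)"
      by (auto intro!: inj_onI beads_inject part)
    show "beads ` self_conjugate_cores t m k = bead_sets t m k"
      using iff part ex by blast
  qed
qed

section \<open>Bead sets of self-conjugate cores as integer sequences\<close>

text \<open>For a set \<open>S\<close> of beads closed under subtracting \<open>t\<close>, the \<open>r\<close>-th entry of the associated word is
  the least \<open>q\<close> with \<open>q * t + r \<notin> S\<close>.\<close>

definition word_set :: "int list \<Rightarrow> int set" where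
  "word_set w = {x. x div int (length w) < w ! nat (x mod int (length w))}"

text \<open>The classes of \<open>r\<close> and \<open>t - 1 - r\<close> carry opposite entries; for
  odd \<open>t\<close> the middle class is its own partner, so its entry is 0.\<close>

definition class_word :: "nat \<Rightarrow> int list \<Rightarrow> int list" where
  "class_word t ns = ns @ (if odd t then [0] else []) @ map uminus (rev ns)"

lemma length_class_word [simp]: "length ns = t div 2 \<Longrightarrow> length (class_word t ns) = t"
  by (cases "even t") (auto simp: class_word_def elim!: evenE oddE)

lemma rev_class_word [simp]: "rev (class_word t ns) = map uminus (class_word t ns)"
  by (auto simp: class_word_def rev_map o_def)

lemma take_class_word: "length ns = s \<Longrightarrow> take s (class_word t ns) = ns"
  by (simp add: class_word_def)

lemma antisymmetric_word_nth:
  assumes "rev w = map uminus w" "r < length w"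
  shows "w ! (length w - Suc r) = - w ! r"
  using arg_cong[OF assms(1), of "\<lambda>xs. xs ! r"] assms(2) by (simp add: rev_nth)

lemma class_word_take:
  fixes w :: "int list"
  assumes "rev w = map uminus w" and t: "length w = t"
  shows "class_word t (take (t div 2) w) = w"
proof (rule nth_equalityI)
  show len: "length (class_word t (take (t div 2) w)) = length w" using t by simp
  fix r assume "r < length (class_word t (take (t div 2) w))"
  then have r: "r < t" using len t by simp
  note opp = antisymmetric_word_nth[OF assms(1), of r, unfolded t, OF r]
  have "r < t div 2 \<or> odd t \<and> r = t div 2 \<or> t - Suc r < t div 2"
    using r by presburger
  then consider "r < t div 2" | "odd t" "r = t div 2" | "t - Suc r < t div 2"
    by blast
  then show "class_word t (take (t div 2) w) ! r = w ! r"
  proof cases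
    case 1
    then show ?thesis using t by (simp add: class_word_def nth_append)
  next
    case 2
    then have "t - Suc r = r" using r by (auto elim!: oddE)
    then show ?thesis using 2 t opp by (simp add: class_word_def nth_append)
  next
    case 3
    have "class_word t (take (t div 2) w) ! (t - Suc r) = w ! (t - Suc r)"
      using 3 t by (simp add: class_word_def nth_append)
    moreover have "class_word t (take (t div 2) w) ! (t - Suc r) = - class_word t (take (t div 2) w) ! r"
      using antisymmetric_word_nth[OF rev_class_word, of r t "take (t div 2) w"] r len t by simp
    ultimately show ?thesis using opp by simp
  qed
qed

lemma mem_word_set:
  assumes "r < length w"
  shows "q * int (length w) + int r \<in> word_set w \<longleftrightarrow> q < w ! r"
proof -
  have "(q * int (length w) + int r) div int (length w) = q"
    "(q * int (length w) + int r) mod int (length w) = int r"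
    by (rule int_div_pos_eq[where r = "int r"] int_mod_pos_eq[where q = q]; use assms in simp)+
  then show ?thesis by (simp add: word_set_def)
qed

lemma div_mod_cases:
  assumes "0 < t"
  obtains q r where "r < t" "x = q * int t + int r"
proof
  show "nat (x mod int t) < t" using assms by (simp add: nat_less_iff)
  show "x = x div int t * int t + int (nat (x mod int t))" using assms by simp
qed

lemma word_set_inject:
  assumes len: "length w' = length w" and eq: "word_set w = word_set w'"
  shows "w = w'"
proof (rule nth_equalityI)
  fix r assume r: "r < length w"
  have "q < w ! r \<longleftrightarrow> q < w' ! r" for q
    using mem_word_set[OF r, of q] mem_word_set[of r w' q] r len eq by simp
  from this[of "w ! r"] this[of "w' ! r"] show "w ! r = w' ! r" by simp
qed (use len in simp)

text \<open>With \<open>t = length w\<close>, reflecting \<open>q * t + r\<close> gives quotient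
  \<open>- 1 - q\<close> and residue \<open>t - 1 - r\<close>, whose entry is negated.\<close>

lemma word_set_self_dual:
  assumes "rev w = map uminus w" "w \<noteq> []"
  shows "x \<in> word_set w \<longleftrightarrow> - 1 - x \<notin> word_set w"
proof -
  obtain q r where r: "r < length w" and x: "x = q * int (length w) + int r"
    using div_mod_cases[OF length_greater_0_conv[THEN iffD2, OF assms(2)], of x] by blast
  have "- 1 - x = (- 1 - q) * int (length w) + int (length w - Suc r)"
    using r by (simp add: x of_nat_diff algebra_simps)
  then have "- 1 - x \<in> word_set w \<longleftrightarrow> - 1 - q < - w ! r"
    using mem_word_set[of "length w - Suc r" w "- 1 - q"] r antisymmetric_word_nth[OF assms(1) r]
    by (metis diff_less zero_less_Suc gr0I length_0_conv assms(2))
  moreover have "x \<in> word_set w \<longleftrightarrow> q < w ! r"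
    using mem_word_set[OF r, of q] x by simp
  ultimately show ?thesis by linarith
qed

lemma word_set_closed:
  assumes "w \<noteq> []" "x \<in> word_set w"
  shows "x - int (length w) \<in> word_set w"
proof -
  obtain q r where r: "r < length w" and x: "x = q * int (length w) + int r"
    using div_mod_cases[OF length_greater_0_conv[THEN iffD2, OF assms(1)], of x] by blast
  have "x - int (length w) = (q - 1) * int (length w) + int r"
    by (simp add: x algebra_simps)
  then show ?thesis
    using mem_word_set[OF r, of q] mem_word_set[OF r, of "q - 1"] assms(2) x
    by (metis less_trans zero_less_one diff_less_eq less_add_same_cancel1)
qed

lemma card_word_set_corners:
  assumes w: "rev w = map uminus w" and len: "length w = Suc n"
  shows "int (card {x \<in> word_set w. x - 1 \<notin> word_set w}) =
    int (nat (2 * w ! 0 - 1)) + (\<Sum>r<n. int (nat (w ! Suc r - w ! r)))"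
proof -
  let ?T = "int (length w)"
  have pos: "0 < length w" using len by simp
  \<comment> \<open>The least quotient in class \<open>r\<close> whose predecessor is no bead. For
    \<open>r > 0\<close> the predecessor has the same quotient in class \<open>r - 1\<close>; for
    \<open>r = 0\<close> its quotient drops by 1 and its class is the last one, whose entry is
    \<open>- w ! 0\<close>.\<close>
  define v where "v r = (if r = 0 then 1 - w ! 0 else w ! (r - 1))" for r
  define A where "A r = (\<lambda>q. q * ?T + int r) ` {v r..<w ! r}" for r
  have iff: "q * ?T + int r - 1 \<notin> word_set w \<longleftrightarrow> v r \<le> q" if r: "r < length w" for q r
  proof (cases r)
    case 0
    have eq: "q * ?T + int r - 1 = (q - 1) * ?T + int n"
      using 0 len by (simp add: algebra_simps)
    have "w ! n = - w ! 0"
      using antisymmetric_word_nth[OF w, of 0] len by simp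
    then show ?thesis
      unfolding eq using mem_word_set[of n w "q - 1"] len 0 by (auto simp: v_def)
  next
    case (Suc r')
    have eq: "q * ?T + int r - 1 = q * ?T + int r'" using Suc by simp
    show ?thesis
      unfolding eq using mem_word_set[of r' w q] r Suc by (auto simp: v_def)
  qed
  have "{x \<in> word_set w. x - 1 \<notin> word_set w} = (\<Union>r\<in>{..<length w}. A r)"
  proof (intro equalityI subsetI)
    fix x assume x: "x \<in> {x \<in> word_set w. x - 1 \<notin> word_set w}"
    obtain q r where r: "r < length w" and xq: "x = q * ?T + int r"
      using div_mod_cases[of "length w"] pos by blast
    have "q \<in> {v r..<w ! r}" using x iff[OF r, of q] mem_word_set[OF r, of q] by (simp add: xq)
    then have "x \<in> A r" unfolding A_def xq by (rule imageI)
    then show "x \<in> (\<Union>r\<in>{..<length w}. A r)" using r by blast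
  next
    fix x assume "x \<in> (\<Union>r\<in>{..<length w}. A r)"
    then obtain r where r: "r < length w" and "x \<in> A r" by blast
    then obtain q where xq: "x = q * ?T + int r" and q: "q \<in> {v r..<w ! r}"
      unfolding A_def by blast
    then show "x \<in> {x \<in> word_set w. x - 1 \<notin> word_set w}"
      using iff[OF r, of q] mem_word_set[OF r, of q] by simp
  qed
  moreover have "card (\<Union>r\<in>{..<length w}. A r) = (\<Sum>r<length w. card (A r))"
  proof (rule card_UN_disjoint)
    have md: "x mod ?T = int r" if "x \<in> A r" "r < length w" for x r
      using that by (auto simp: A_def)
    show "\<forall>i\<in>{..<length w}. \<forall>j\<in>{..<length w}. i \<noteq> j \<longrightarrow> A i \<inter> A j = {}"
    proof (intro ballI impI)
      fix i j assume ij: "i \<in> {..<length w}" "j \<in> {..<length w}" "i \<noteq> j"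
      have "\<not> (x \<in> A i \<and> x \<in> A j)" for x
        using md[of x i] md[of x j] ij by auto
      then show "A i \<inter> A j = {}" by blast
    qed
  qed (auto simp: A_def)
  moreover have "card (A r) = nat (w ! r - v r)" for r
    unfolding A_def by (subst card_image) (use len in \<open>auto simp: inj_on_def\<close>)
  ultimately have "int (card {x \<in> word_set w. x - 1 \<notin> word_set w}) =
      (\<Sum>r<Suc n. int (nat (w ! r - v r)))"
    by (simp only: len of_nat_sum)
  also have "\<dots> = int (nat (w ! 0 - v 0)) + (\<Sum>r<n. int (nat (w ! Suc r - v (Suc r))))"
    by (rule sum.lessThan_Suc_shift)
  finally show ?thesis by (simp add: v_def algebra_simps)
qed

text \<open>The second half retraces the first with opposite signs. For odd \<open>t\<close> the
  middle 0 separates two equal variations; for even \<open>t\<close> the jump from the last entry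
  \<open>z\<close> to \<open>- z\<close> costs as much as passing through 0.\<close>

lemma tv_class_word: "tv 0 (class_word t ns) 0 = 2 * tv 0 ns 0"
proof (cases "odd t")
  case True
  have "tv 0 (map uminus (rev ns)) 0 = tv 0 ns 0"
    unfolding tv_uminus using tv_rev[of 0 ns 0] by simp
  then show ?thesis using True by (simp add: class_word_def tv_append)
next
  case False
  show ?thesis
  proof (cases ns rule: rev_cases)
    case (snoc ms z)
    have "tv (- z) (map uminus (rev ms)) 0 = tv 0 ms z"
      unfolding tv_uminus using tv_rev[of z ms 0] by simp
    then show ?thesis using False snoc by (simp add: class_word_def tv_append)
  qed (use False in \<open>simp add: class_word_def\<close>)
qed

lemma tv_eq_sum:
  assumes "length w = Suc n"
  shows "tv 0 w 0 = \<bar>w ! 0\<bar> + (\<Sum>r<n. \<bar>w ! Suc r - w ! r\<bar>) + \<bar>w ! n\<bar>"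
proof -
  have "tv 0 w 0 = \<bar>w ! 0\<bar> + (\<Sum>r\<le>n. \<bar>(w @ [0]) ! Suc r - (w @ [0]) ! r\<bar>)"
    using sum_telescope_list[of 0 w 0] assms
    by (simp add: sum.atMost_Suc_shift nth_append del: sum.atMost_Suc)
  also have "(\<Sum>r\<le>n. \<bar>(w @ [0]) ! Suc r - (w @ [0]) ! r\<bar>) =
      (\<Sum>r<n. \<bar>(w @ [0]) ! Suc r - (w @ [0]) ! r\<bar>) + \<bar>w ! n\<bar>"
    using assms by (simp add: lessThan_Suc_atMost[symmetric] nth_append)
  also have "(\<Sum>r<n. \<bar>(w @ [0]) ! Suc r - (w @ [0]) ! r\<bar>) = (\<Sum>r<n. \<bar>w ! Suc r - w ! r\<bar>)"
    using assms by (intro sum.cong) (auto simp: nth_append)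
  finally show ?thesis by simp
qed

text \<open>Twice the positive part of a difference is its absolute value plus itself, so the sum of
  the rises is half of a total variation plus a telescoping sum. Class 0 contributes
  \<open>nat (2 * h - 1)\<close>, which yields the correction in \<open>cost\<close>.\<close>

lemma card_corners_class_word:
  assumes t: "0 < t" and ns: "length ns = t div 2"
  shows "int (card {x \<in> word_set (class_word t ns). x - 1 \<notin> word_set (class_word t ns)}) = cost ns"
proof -
  define w where "w = class_word t ns"
  define h where "h = hd (ns @ [0])"
  obtain n where n: "t = Suc n" using t by (cases t) auto
  have len: "length w = Suc n" using ns n by (simp add: w_def)
  have sym: "rev w = map uminus w" by (simp add: w_def)
  have w0: "w ! 0 = h"
    using ns n by (cases ns) (auto simp: w_def h_def class_word_def elim!: evenE)
  have wn: "w ! n = - h"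
    using antisymmetric_word_nth[OF sym, of 0] len w0 by simp
  have "2 * (\<Sum>r<n. int (nat (w ! Suc r - w ! r))) =
      (\<Sum>r<n. \<bar>w ! Suc r - w ! r\<bar> + (w ! Suc r - w ! r))"
    unfolding sum_distrib_left by (intro sum.cong) auto
  also have "\<dots> = (\<Sum>r<n. \<bar>w ! Suc r - w ! r\<bar>) + (w ! n - w ! 0)"
    using sum_lessThan_telescope[of "\<lambda>r. w ! r" n] by (simp add: sum.distrib)
  also have "\<dots> = 2 * tv 0 ns 0 - 2 * \<bar>h\<bar> - 2 * h"
    using tv_eq_sum[OF len] tv_class_word[of t ns] w0 wn by (simp add: w_def)
  finally have "(\<Sum>r<n. int (nat (w ! Suc r - w ! r))) = tv 0 ns 0 - \<bar>h\<bar> - h" by simp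
  then show ?thesis
    using card_word_set_corners[OF sym len] w0 by (auto simp: cost_def h_def[symmetric] w_def[symmetric])
qed

text \<open>The largest bead of the class is \<open>(n - 1) * t + r\<close>. Below the middle class,
  \<open>2 * r + 1\<close> lies strictly between 0 and \<open>t\<close>, so the bound becomes
  \<open>2 * (n - 1) < k\<close>.\<close>

lemma lower_class_bound:
  fixes n :: int and k t r :: nat
  assumes "2 * r + 1 < t"
  shows "2 * ((n - 1) * int t + int r) + 1 < int (k * t) \<longleftrightarrow> n \<le> int ((k + 1) div 2)"
proof
  assume *: "2 * ((n - 1) * int t + int r) + 1 < int (k * t)"
  show "n \<le> int ((k + 1) div 2)"
  proof (rule ccontr)
    assume "\<not> n \<le> int ((k + 1) div 2)"
    then have "int k \<le> 2 * (n - 1)" by presburger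
    then have "int k * int t \<le> 2 * (n - 1) * int t" by (intro mult_right_mono) auto
    then show False using * by (simp add: algebra_simps)
  qed
next
  assume "n \<le> int ((k + 1) div 2)"
  then have "2 * (n - 1) \<le> int k - 1" by presburger
  then have "2 * (n - 1) * int t \<le> (int k - 1) * int t" by (intro mult_right_mono) auto
  then show "2 * ((n - 1) * int t + int r) + 1 < int (k * t)"
    using assms by (simp add: algebra_simps)
qed

text \<open>Above the middle class, \<open>2 * r + 1\<close> lies strictly between \<open>t\<close>
  and \<open>2 * t\<close>, so the bound becomes \<open>2 * n \<le> k\<close>.\<close>

lemma upper_class_bound:
  fixes n :: int and k t r :: nat
  assumes "t < 2 * r + 1" "r < t"
  shows "2 * ((n - 1) * int t + int r) + 1 < int (k * t) \<longleftrightarrow> n \<le> int (k div 2)"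
proof
  assume *: "2 * ((n - 1) * int t + int r) + 1 < int (k * t)"
  show "n \<le> int (k div 2)"
  proof (rule ccontr)
    assume "\<not> n \<le> int (k div 2)"
    then have "int k \<le> 2 * n - 1" by linarith
    then have "int k * int t \<le> (2 * n - 1) * int t" by (intro mult_right_mono) auto
    then show False using * assms by (simp add: algebra_simps)
  qed
next
  assume "n \<le> int (k div 2)"
  then have "2 * n \<le> int k" by linarith
  then have "2 * n * int t \<le> int k * int t" by (intro mult_right_mono) auto
  moreover have "2 * ((n - 1) * int t + int r) + 1 = 2 * n * int t - 2 * int t + 2 * int r + 1"
    by (simp add: algebra_simps)
  ultimately show "2 * ((n - 1) * int t + int r) + 1 < int (k * t)"
    using assms unfolding of_nat_mult by linarith
qed

lemma word_set_bound:
  assumes "w \<noteq> []"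
  shows "(\<forall>x\<in>word_set w. 2 * x + 1 < b) \<longleftrightarrow>
    (\<forall>r<length w. 2 * ((w ! r - 1) * int (length w) + int r) + 1 < b)"
proof
  assume *: "\<forall>x\<in>word_set w. 2 * x + 1 < b"
  show "\<forall>r<length w. 2 * ((w ! r - 1) * int (length w) + int r) + 1 < b"
  proof (intro allI impI)
    fix r assume "r < length w"
    then have "(w ! r - 1) * int (length w) + int r \<in> word_set w" by (simp add: mem_word_set)
    then show "2 * ((w ! r - 1) * int (length w) + int r) + 1 < b" using * by blast
  qed
next
  assume *: "\<forall>r<length w. 2 * ((w ! r - 1) * int (length w) + int r) + 1 < b"
  show "\<forall>x\<in>word_set w. 2 * x + 1 < b"
  proof
    fix x assume x: "x \<in> word_set w"
    obtain q r where r: "r < length w" and xq: "x = q * int (length w) + int r"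
      using div_mod_cases[OF length_greater_0_conv[THEN iffD2, OF assms], of x] by blast
    have "q \<le> w ! r - 1" using x mem_word_set[OF r, of q] by (simp add: xq)
    then have "q * int (length w) \<le> (w ! r - 1) * int (length w)" by (intro mult_right_mono) auto
    moreover have "2 * ((w ! r - 1) * int (length w) + int r) + 1 < b" using * r by blast
    ultimately show "2 * x + 1 < b" unfolding xq by (smt (verit))
  qed
qed

text \<open>The class of \<open>r\<close> bounds \<open>ns ! r\<close> from above; its partner, with
  the negated entry, bounds it from below.\<close>

lemma class_word_bound:
  assumes t: "0 < t" and ns: "length ns = t div 2"
  shows "(\<forall>x\<in>word_set (class_word t ns). 2 * x + 1 < int (k * t)) \<longleftrightarrow>
    set ns \<subseteq> {- int (k div 2)..int ((k + 1) div 2)}"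
proof -
  define w where "w = class_word t ns"
  have len: "length w = t" and sym: "rev w = map uminus w" using ns by (simp_all add: w_def)
  have nth: "w ! r = ns ! r" if "r < t div 2" for r
    using that ns by (simp add: w_def class_word_def nth_append)
  have opp: "w ! (t - Suc r) = - w ! r" if "r < t" for r
    using antisymmetric_word_nth[OF sym, of r] that len by simp
  define P where "P r \<longleftrightarrow> 2 * ((w ! r - 1) * int t + int r) + 1 < int (k * t)" for r
  have low: "P r \<longleftrightarrow> ns ! r \<le> int ((k + 1) div 2)" if "r < t div 2" for r
    using lower_class_bound[of r t "w ! r" k] nth[OF that] that by (simp add: P_def)
  have up: "P (t - Suc r) \<longleftrightarrow> - int (k div 2) \<le> ns ! r" if "r < t div 2" for r
  proof -
    have "t < 2 * (t - Suc r) + 1" "t - Suc r < t" "r < t" using that by auto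
    then have "P (t - Suc r) \<longleftrightarrow> - ns ! r \<le> int (k div 2)"
      using upper_class_bound[of t "t - Suc r" "w ! (t - Suc r)" k] opp[of r] nth[OF that]
      unfolding P_def by simp
    then show ?thesis by linarith
  qed
  \<comment> \<open>For odd \<open>t\<close> the largest bead \<open>x\<close> of the middle class
    satisfies \<open>2 * x + 1 = - t\<close>, so the bound holds automatically.\<close>
  have mid: "P r" if r: "2 * r + 1 = t" for r
  proof -
    have "w ! r = - w ! r" using opp[of r] r by (simp add: r[symmetric])
    then have "w ! r = 0" by simp
    then have "2 * ((w ! r - 1) * int t + int r) + 1 = - int t"
      using arg_cong[OF r, of int] by simp
    also have "\<dots> < int (k * t)" using t of_nat_0_le_iff[of "k * t", where 'a = int] by linarith
    finally show ?thesis by (simp add: P_def)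
  qed
  have "(\<forall>r<t. P r) \<longleftrightarrow> (\<forall>r<t div 2. P r \<and> P (t - Suc r))"
  proof (intro iffI allI impI)
    fix r assume *: "\<forall>r<t div 2. P r \<and> P (t - Suc r)" and r: "r < t"
    consider "r < t div 2" | "2 * r + 1 = t" | "t - Suc r < t div 2"
      using r by linarith
    then show "P r"
    proof cases
      case 3
      then have "P (t - Suc (t - Suc r))" using * by blast
      then show ?thesis using r by (simp add: Suc_diff_Suc)
    qed (use * mid in auto)
  qed (use t in auto)
  also have "\<dots> \<longleftrightarrow> (\<forall>r<t div 2. ns ! r \<in> {- int (k div 2)..int ((k + 1) div 2)})"
    using low up by auto
  also have "\<dots> \<longleftrightarrow> set ns \<subseteq> {- int (k div 2)..int ((k + 1) div 2)}"
    unfolding subset_eq all_set_conv_all_nth ns by simp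
  finally show ?thesis
    using word_set_bound[of w "int (k * t)"] len t unfolding P_def w_def[symmetric] by auto
qed

lemma class_word_in_bead_sets_iff:
  assumes t: "0 < t" and ns: "length ns = t div 2"
  shows "word_set (class_word t ns) \<in> bead_sets t m k \<longleftrightarrow> ns \<in> core_sequences (t div 2) m k"
proof -
  have ne: "class_word t ns \<noteq> []" using t length_class_word[OF ns] by auto
  have "word_set (class_word t ns) \<in> bead_sets t m k \<longleftrightarrow>
      card {x \<in> word_set (class_word t ns). x - 1 \<notin> word_set (class_word t ns)} = m \<and>
      (\<forall>x\<in>word_set (class_word t ns). 2 * x + 1 < int (k * t))"
    unfolding bead_sets_def mem_Collect_eq
    using word_set_self_dual[OF rev_class_word ne]
      word_set_closed[OF ne, unfolded length_class_word[OF ns]] by blast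
  also have "\<dots> \<longleftrightarrow> cost ns = int m \<and> set ns \<subseteq> {- int (k div 2)..int ((k + 1) div 2)}"
    unfolding class_word_bound[OF t ns] card_corners_class_word[OF t ns, symmetric] by simp
  also have "\<dots> \<longleftrightarrow> ns \<in> core_sequences (t div 2) m k"
    using ns by (auto simp: core_sequences_eq lists_between_def)
  finally show ?thesis .
qed

section \<open>Every bead set comes from a class word\<close>

lemma int_threshold:
  fixes P :: "int \<Rightarrow> bool"
  assumes down: "\<And>q. P q \<Longrightarrow> P (q - 1)" and ex: "P a" and bd: "\<And>q. P q \<Longrightarrow> q < b"
  shows "\<exists>n. \<forall>q. P q \<longleftrightarrow> q < n"
proof -
  define M where "M = Max {q. a \<le> q \<and> P q}"
  have fin: "finite {q. a \<le> q \<and> P q}"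
    by (rule finite_subset[of _ "{a..<b}"]) (use bd in auto)
  have M: "P M" "a \<le> M" "\<And>q. P q \<Longrightarrow> q \<le> M"
  proof -
    have "M \<in> {q. a \<le> q \<and> P q}" unfolding M_def using fin ex by (intro Max_in) auto
    then show "P M" "a \<le> M" by auto
    show "q \<le> M" if "P q" for q
      using Max_ge[OF fin, of q] \<open>a \<le> M\<close> that by (cases "a \<le> q") (auto simp: M_def)
  qed
  have "P q" if "q \<le> M" for q
    using that by (induction rule: int_le_induct) (use M down in auto)
  then have "P q \<longleftrightarrow> q < M + 1" for q using M(3)[of q] by auto
  then show ?thesis by blast
qed

lemma ex_class_word:
  assumes t: "0 < t" and S: "S \<in> bead_sets t m k"
  shows "\<exists>ns. length ns = t div 2 \<and> word_set (class_word t ns) = S"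
proof -
  have sd: "x \<in> S \<longleftrightarrow> - 1 - x \<notin> S" and cl: "x \<in> S \<Longrightarrow> x - int t \<in> S"
    and bd: "x \<in> S \<Longrightarrow> 2 * x + 1 < int (k * t)" for x
    using S unfolding bead_sets_def by blast+
  have "\<exists>n. \<forall>q. q * int t + int r \<in> S \<longleftrightarrow> q < n" if r: "r < t" for r
  proof (rule int_threshold)
    show "(q - 1) * int t + int r \<in> S" if "q * int t + int r \<in> S" for q
      using cl[OF that] by (simp add: algebra_simps)
    have less: "q < int k + 1" if "q * int t + int r \<in> S" for q
    proof (rule ccontr)
      assume "\<not> q < int k + 1"
      then have "(int k + 1) * int t \<le> q * int t" by (intro mult_right_mono) auto
      then have "int (k * t) + int t \<le> q * int t" by (simp add: algebra_simps)
      then show False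
        using bd[OF that] of_nat_0_le_iff[of "k * t", where 'a = int] by (smt (verit) of_nat_0_le_iff)
    qed
    then show "q * int t + int r \<in> S \<Longrightarrow> q < int k + 1" for q .
    \<comment> \<open>Otherwise its dual would be a bead beyond the upper bound; thus every class
      contains a bead.\<close>
    show "(- int k - 2) * int t + int r \<in> S"
    proof (rule ccontr)
      assume "(- int k - 2) * int t + int r \<notin> S"
      then have "- 1 - ((- int k - 2) * int t + int r) \<in> S"
        using sd[of "(- int k - 2) * int t + int r"] by blast
      note bd[OF this]
      moreover have "0 \<le> int k * int t" by simp
      ultimately show False using r by (simp add: algebra_simps)
    qed
  qed
  then obtain f where f: "r < t \<Longrightarrow> q * int t + int r \<in> S \<longleftrightarrow> q < f r" for r q
    by metis
  define w where "w = map f [0..<t]"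
  have len: "length w = t" by (simp add: w_def)
  have mem: "x \<in> word_set w \<longleftrightarrow> x \<in> S" for x
  proof -
    obtain q r where r: "r < t" and x: "x = q * int t + int r"
      using div_mod_cases[OF t, of x] by blast
    show ?thesis using mem_word_set[of r w q] f[OF r, of q] r by (simp add: x len) (simp add: w_def)
  qed
  have "rev w = map uminus w"
  proof (rule nth_equalityI)
    fix r assume "r < length (rev w)"
    then have r: "r < t" by (simp add: len)
    have "q < f (t - Suc r) \<longleftrightarrow> q < - f r" for q
    proof -
      have "q < f (t - Suc r) \<longleftrightarrow> q * int t + int (t - Suc r) \<in> S" using f[of "t - Suc r" q] r by simp
      also have "\<dots> \<longleftrightarrow> - 1 - (q * int t + int (t - Suc r)) \<notin> S" by (rule sd)
      also have "- 1 - (q * int t + int (t - Suc r)) = (- 1 - q) * int t + int r"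
        using r by (simp add: of_nat_diff algebra_simps)
      also have "\<dots> \<notin> S \<longleftrightarrow> q < - f r" using f[OF r, of "- 1 - q"] by auto
      finally show ?thesis .
    qed
    from this[of "f (t - Suc r)"] this[of "- f r"] have "f (t - Suc r) = - f r" by simp
    then show "rev w ! r = map uminus w ! r" using r by (simp add: rev_nth len) (simp add: w_def)
  qed simp
  then have "class_word t (take (t div 2) w) = w" using len by (rule class_word_take)
  moreover have "length (take (t div 2) w) = t div 2" by (simp add: len)
  moreover have "word_set w = S" using mem by blast
  ultimately show ?thesis by metis
qed

lemma bij_betw_class_word:
  assumes t: "0 < t"
  shows "bij_betw (\<lambda>ns. word_set (class_word t ns)) (core_sequences (t div 2) m k) (bead_sets t m k)"
  unfolding bij_betw_def
proof
  have len: "length ns = t div 2" if "ns \<in> core_sequences (t div 2) m k" for ns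
    using that by (simp add: core_sequences_def)
  show "inj_on (\<lambda>ns. word_set (class_word t ns)) (core_sequences (t div 2) m k)"
  proof (rule inj_onI)
    fix ns ns' assume ns: "ns \<in> core_sequences (t div 2) m k" "ns' \<in> core_sequences (t div 2) m k"
      "word_set (class_word t ns) = word_set (class_word t ns')"
    then have "class_word t ns = class_word t ns'"
      by (intro word_set_inject) (simp_all add: len)
    then show "ns = ns'" using take_class_word len ns by metis
  qed
  show "(\<lambda>ns. word_set (class_word t ns)) ` core_sequences (t div 2) m k = bead_sets t m k"
    using class_word_in_bead_sets_iff[OF t] ex_class_word[OF t] len by blast
qed

lemma self_conjugate_cores_eqpoll_core_sequences:
  "self_conjugate_cores t m k \<approx> core_sequences (t div 2) m k"
proof (cases "t = 0")
  case True
  \<comment> \<open>For \<open>t = 0\<close> the bound on the first hook is 0, which leaves only the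
    empty partition, with no corners.\<close>
  have "self_conjugate []" by (simp add: self_conjugate_def conjugate_def)
  moreover have "young_diagram [] = {}" by (auto simp: young_diagram_def)
  moreover from this have "inner_corners [] = {}" by (simp add: inner_corners_def)
  ultimately have "self_conjugate_cores 0 m k = (if m = 0 then {[]} else {})"
    by (auto simp: self_conjugate_cores_def is_partition_def t_core_def)
  moreover have "core_sequences 0 m k = (if m = 0 then {[]} else {})"
    by (auto simp: core_sequences_eq cost_def)
  ultimately show ?thesis using True by (simp add: eqpoll_iff_card)
next
  case False
  then have "self_conjugate_cores t m k \<approx> bead_sets t m k"
    using bij_betw_beads unfolding eqpoll_def by blast
  also have "\<dots> \<approx> core_sequences (t div 2) m k"
    using bij_betw_class_word False
    by (intro eqpoll_sym[of "core_sequences (t div 2) m k"]) (auto simp: eqpoll_def)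
  finally show ?thesis .
qed

theorem theorem3p7:
  fixes t m k s :: nat
  assumes "s = t div 2"
  shows "self_conjugate_cores t m k \<approx> core_sequences s m k
       \<and> self_conjugate_cores t m k \<approx> Free_c m s k
       \<and> self_conjugate_cores t m k \<approx> Pre_c m s k
       \<and> self_conjugate_cores t m k \<approx> sym_motzkin_c t m k
       \<and> core_sequences s m k \<approx> Free_c m s k
       \<and> core_sequences s m k \<approx> Pre_c m s k
       \<and> core_sequences s m k \<approx> sym_motzkin_c t m k
       \<and> Free_c m s k \<approx> Pre_c m s k
       \<and> Free_c m s k \<approx> sym_motzkin_c t m k
       \<and> Pre_c m s k \<approx> sym_motzkin_c t m k"
proof -
  have ab: "self_conjugate_cores t m k \<approx> core_sequences s m k"
    using self_conjugate_cores_eqpoll_core_sequences assms by simp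
  have bc: "core_sequences s m k \<approx> Free_c m s k" by (rule core_sequences_eqpoll_Free_c)
  have bd: "core_sequences s m k \<approx> Pre_c m s k" by (rule core_sequences_eqpoll_Pre_c)
  have de: "Pre_c m s k \<approx> sym_motzkin_c t m k"
    using Pre_c_eqpoll_sym_motzkin_c assms by simp
  have be: "core_sequences s m k \<approx> sym_motzkin_c t m k" using bd de by (rule eqpoll_trans)
  have cb: "Free_c m s k \<approx> core_sequences s m k" using bc by (rule eqpoll_sym)
  show ?thesis
    using ab bc bd be de eqpoll_trans[OF ab bc] eqpoll_trans[OF ab bd] eqpoll_trans[OF ab be]
      eqpoll_trans[OF cb bd] eqpoll_trans[OF cb be] by blast
qed

end
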